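(* Let $\mathcal U\subseteq\mathbb R^p$ be a set containing $\hat\theta$, the minimizer of $f$. For any symmetric positive definite $\mathbb D\in\mathbb R^{p\times p}$ such that $\lambda(\mathcal U,\mathbb D):=\alpha(\mathbb D)^{-2}-\omega_3(\mathcal U,\mathbb D)>0$, it holds $$\mathrm{TV}(\pi_f,\gamma_f)\le \frac{\tau_3(\mathcal U,\mathbb D)}{4\sqrt{\lambda(\mathcal U,\mathbb D)\,\gamma_f(\mathcal U)}}\Big(\mathrm{Tr}(\mathbb D_G^{-2}\mathbb D^2)+\|\mathbb D_G^{-1}\mathbb D\|^2\Big)+\pi_f(\mathcal U^c)+\gamma_f(\mathcal U^c).$$
   Context: Let $p\ge1$ and let $f:\mathbb R^p\to\mathbb R$ be at least three times differentiable, with a unique global minimizer $\hat\theta$, and such that $\pi_f(\theta)\propto e^{-f(\theta)}$ is a probability density on $\mathbb R^p$; $\pi_f$ also denotes the corresponding probability measure. Let $\mathbb D_G\succ0$ be the symmetric positive definite matrix with $\mathbb D_G^2=\nabla^2 f(\hat\theta)$ (assumed positive definite). The Laplace approximation to $\pi_f$ is the Gaussian $\gamma_f=\mathcal N(\hat\theta,\mathbb D_G^{-2})$. $\mathrm{TV}$ is total variation distance, $\mathrm{TV}(\mu,\nu)=\sup_A|\mu(A)-\nu(A)|$. $\|\cdot\|$ is the Euclidean norm of vectors and the operator norm of matrices. For symmetric $\mathbb D\succ0$ and a set $\mathcal U\ni\hat\theta$ define $\alpha(\mathbb D)=\|\mathbb D_G^{-1}\mathbb D\|$ and $$\omega_3(\mathcal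 U,\mathbb D)=\sup_{\theta\in\mathcal U}\big\|\mathbb D^{-1}(\nabla^2f(\theta)-\nabla^2f(\hat\theta))\mathbb D^{-1}\big\|,\qquad \tau_3(\mathcal U,\mathbb D)=\sup_{\theta\in\mathcal U,\ \theta\ne\hat\theta}\frac{\big\|\mathbb D^{-1}(\nabla^2f(\theta)-\nabla^2f(\hat\theta))\mathbb D^{-1}\big\|}{\|\mathbb D(\theta-\hat\theta)\|}.$$
   Formalization: The set U is additionally assumed convex (and Borel, as π_f(U) requires); for non-convex U the stated inequality fails, e.g. in dimension one when U omits a short interval across which f jumps steeply. *)

theory Defs
  imports "HOL-Probability.Probability"
begin

definition gradient :: "(real ^ 'n \<Rightarrow> real) \<Rightarrow> real ^ 'n \<Rightarrow> real ^ 'n" where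
  "gradient f x = (\<chi> i. frechet_derivative f (at x) (axis i 1))"

definition hessian :: "(real ^ 'n \<Rightarrow> real) \<Rightarrow> real ^ 'n \<Rightarrow> real ^ 'n ^ 'n" where
  "hessian f x = matrix (frechet_derivative (gradient f) (at x))"

(* Frechet differentiability of order three; once the previous order exists everywhere,
   differentiability of the gradient (Hessian) is that of the first (second) derivative. *)
definition thrice_differentiable :: "(real ^ 'n \<Rightarrow> real) \<Rightarrow> bool" where
  "thrice_differentiable f \<longleftrightarrow>
     (\<forall>x. f differentiable (at x)) \<and>
     (\<forall>x. gradient f differentiable (at x)) \<and>
     (\<forall>x. hessian f differentiable (at x))"

definition sym_pos_def :: "real ^ 'n ^ 'n \<Rightarrow> bool" where
  "sym_pos_def A \<longleftrightarrow> transpose A = A \<and> (\<forall>x. x \<noteq> 0 \<longrightarrow> 0 < x \<bullet> (A *v x))"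

(* The library's norm on matrices is the Frobenius norm, hence onorm. *)
definition opnorm :: "real ^ 'n ^ 'm \<Rightarrow> real" where
  "opnorm A = onorm ((*v) A)"

definition gibbs_measure :: "(real ^ 'n \<Rightarrow> real) \<Rightarrow> (real ^ 'n) measure" where
  "gibbs_measure f =
     density lborel (\<lambda>x. ennreal (exp (- f x) / (\<integral>y. exp (- f y) \<partial>lborel)))"

(* Mean m, covariance matrix S. *)
definition gaussian_measure :: "real ^ 'n \<Rightarrow> real ^ 'n ^ 'n \<Rightarrow> (real ^ 'n) measure" where
  "gaussian_measure m S =
     density lborel (\<lambda>x. ennreal (exp (- ((x - m) \<bullet> (matrix_inv S *v (x - m))) / 2)
                                / sqrt ((2 * pi) ^ CARD('n) * det S)))"

(* Intended for probability measures on the same sigma-algebra. *)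
definition TV :: "'a measure \<Rightarrow> 'a measure \<Rightarrow> real" where
  "TV M N = (SUP A\<in>sets M. \<bar>measure M A - measure N A\<bar>)"

definition alpha :: "real ^ 'n ^ 'n \<Rightarrow> real ^ 'n ^ 'n \<Rightarrow> real" where
  "alpha DG D = opnorm (matrix_inv DG ** D)"

definition hess_dev ::
  "(real ^ 'n \<Rightarrow> real) \<Rightarrow> real ^ 'n \<Rightarrow> real ^ 'n ^ 'n \<Rightarrow> real ^ 'n \<Rightarrow> real" where
  "hess_dev f m D x = opnorm (matrix_inv D ** (hessian f x - hessian f m) ** matrix_inv D)"

(* The suprema may be infinite, so they are taken in [0,\<infinity>]; the supremum of the empty set
   (U = {m} in tau3) is 0 there. *)
definition omega3 ::
  "(real ^ 'n \<Rightarrow> real) \<Rightarrow> real ^ 'n \<Rightarrow> (real ^ 'n) set \<Rightarrow> real ^ 'n ^ 'n \<Rightarrow> ennreal" where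
  "omega3 f m U D = (SUP x\<in>U. ennreal (hess_dev f m D x))"

definition tau3 ::
  "(real ^ 'n \<Rightarrow> real) \<Rightarrow> real ^ 'n \<Rightarrow> (real ^ 'n) set \<Rightarrow> real ^ 'n ^ 'n \<Rightarrow> ennreal" where
  "tau3 f m U D = (SUP x\<in>U - {m}. ennreal (hess_dev f m D x / norm (D *v (x - m))))"

(* Extended real because omega3 may be infinite (then lambda = -\<infinity>); the subtraction is not
   truncated. *)
definition lam ::
  "(real ^ 'n \<Rightarrow> real) \<Rightarrow> real ^ 'n \<Rightarrow> real ^ 'n ^ 'n \<Rightarrow> (real ^ 'n) set \<Rightarrow> real ^ 'n ^ 'n \<Rightarrow> ereal"
  where "lam f m DG U D = ereal (1 / (alpha DG D)\<^sup>2) - enn2ereal (omega3 f m U D)"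

end

theory Submission
  imports Defs
begin

text \<open>Conditioning both measures on \<open>U\<close> costs the two tail terms, so it remains to compare
  \<open>exp (- f)\<close> and \<open>exp (- q)\<close>, \<open>q\<close> the Gaussian potential, restricted to \<open>U\<close>. Instead of Pinsker's
  inequality and a logarithmic Sobolev inequality, total variation is bounded by \<open>sqrt (1 - c\<^sup>2)\<close>
  with \<open>c\<close> the Hellinger affinity; \<open>1 - c\<^sup>2\<close> is the variance of \<open>exp ((f - q) / 2)\<close> under the
  strongly log-concave weight \<open>exp (- f)\<close>, so the Poincare inequality with constant \<open>1 / \<lambda>\<close> gives
  the sharp prefactor. The Poincare inequality is the linearization of Prekopa--Leindler at the
  midpoint. The gradient of \<open>f - q\<close> is at most \<open>\<tau>\<^sub>3 / 2\<close> times the square of \<open>|D (x - m)|\<close>, and the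
  fourth Gaussian moment of \<open>|D (x - m)|\<close> is explicit.\<close>

subsection \<open>The Prekopa--Leindler inequality\<close>

text \<open>The constants come from one choice. For \<open>g = exp ((f - q) / 2)\<close> one has
  \<open>g\<^sup>2 * exp (- f) = exp (- q)\<close>. Under the weight \<open>exp (- f)\<close> on
  \<open>U\<close>, the second moment of \<open>g\<close> is therefore the unnormalized Gaussian
  mass of \<open>U\<close>, its first moment is the unnormalized affinity, and the gradient term of
  the Poincare inequality is bounded by a pure Gaussian integral: no moment of the unknown measure
  has to be controlled. That integral is enlarged to the whole space, while the mass it is divided
  by stays that of \<open>U\<close>; this leaves \<open>measure gamma_f U\<close> under the root.
  The 4 is 2 * 2: one factor from the exponent 1/2, one from integrating a Hessian deviation that
  grows linearly away from \<open>m\<close>. The number \<lambda> bounds the Hessian of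
  \<open>f\<close> on \<open>U\<close> from below in the norm |D k|, so the weight to be treated is
  log-concave but cut off to \<open>U\<close>. Prekopa--Leindler absorbs the indicator of a convex
  set without boundary terms, and strong convexity enters only through midpoints. The price is a
  bounded test function with a one-sided quadratic bound, which is available on bounded
  sets.\<close>

lemma emeasure_le_of_initial_segments:
  fixes A :: "real set"
  assumes A: "A \<in> sets borel" "A \<noteq> {}"
    and le: "\<And>a. a \<in> A \<Longrightarrow> emeasure lborel (A \<inter> {..a}) \<le> c"
  shows "emeasure lborel A \<le> c"
proof -
  have below: "emeasure lborel (A \<inter> {..b}) \<le> c" if "a \<in> A" "b \<le> a" for a b
    using that A by (intro order_trans[OF emeasure_mono le[of a]]) auto
  \<comment> \<open>Continuity from below, for cut-offs that increase, exhaust \<open>A\<close> and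
    each lie below some point of \<open>A\<close>. Such cut-offs are the integers if
    \<open>A\<close> is unbounded above, and \<open>s - 1 / Suc n\<close> if the supremum
    \<open>s\<close> is finite but not attained. If it is attained, \<open>A\<close> is itself one
    of the initial segments.\<close>
  have seq: "emeasure lborel A \<le> c"
    if F: "incseq F" "(\<Union>n. A \<inter> {..F n}) = A" "\<And>n. \<exists>a\<in>A. F n \<le> a" for F :: "nat \<Rightarrow> real"
  proof -
    have "incseq (\<lambda>n. A \<inter> {..F n})"
      using F(1) by (auto simp: incseq_def intro: order_trans)
    then have "emeasure lborel A = (SUP n. emeasure lborel (A \<inter> {..F n}))"
      using A F(2) by (subst SUP_emeasure_incseq) auto
    then show ?thesis
      using F(3) below by (auto intro!: SUP_least)
  qed
  show ?thesis
  proof (cases "bdd_above A")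
    case False
    then show ?thesis
      by (intro seq[of real]) (auto simp: incseq_def bdd_above_def not_le intro: real_arch_simple less_imp_le)
  next
    case True
    define s where "s = Sup A"
    have up: "x \<le> s" if "x \<in> A" for x
      using that True by (auto simp: s_def intro: cSup_upper)
    show ?thesis
    proof (cases "s \<in> A")
      case True
      then have "A \<inter> {..s} = A" using up by auto
      then show ?thesis using le[OF True] by simp
    next
      case False
      show ?thesis
      proof (rule seq[of "\<lambda>n. s - 1 / Suc n"])
        show "incseq (\<lambda>n. s - 1 / real (Suc n))"
          by (auto simp: incseq_def intro!: divide_left_mono)
        show "\<exists>a\<in>A. s - 1 / real (Suc n) \<le> a" for n
          using less_cSup_iff[of A "s - 1 / real (Suc n)"] A True
          by (force simp: s_def intro: less_imp_le)
        show "(\<Union>n. A \<inter> {..s - 1 / real (Suc n)}) = A"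
        proof (intro equalityI subsetI)
          fix x assume x: "x \<in> A"
          with up[OF x] False have "0 < s - x" by (cases "x = s") auto
          from nat_approx_posE[OF this] obtain n where "1 / real (Suc n) < s - x" .
          with x show "x \<in> (\<Union>n. A \<inter> {..s - 1 / real (Suc n)})"
            by (auto intro!: exI[of _ n])
        qed auto
      qed
    qed
  qed
qed

lemma emeasure_lborel_translate:
  fixes A :: "'a::euclidean_space set"
  assumes "A \<in> sets borel"
  shows "emeasure lborel ((\<lambda>x. x - c) -` A) = emeasure lborel A"
proof -
  have "emeasure (distr lborel borel ((+) (- c))) A = emeasure lborel A"
    by (simp add: lborel_distr_plus)
  moreover have "(+) (- c) -` A = (\<lambda>x. x - c) -` A" by (auto simp: add.commute)
  ultimately show ?thesis
    using assms by (subst (asm) emeasure_distr) auto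
qed

lemma emeasure_lborel_uminus:
  fixes A :: "real set"
  assumes "A \<in> sets borel"
  shows "emeasure lborel (uminus -` A) = emeasure lborel A"
proof -
  have "emeasure (distr lborel borel uminus) A = emeasure lborel A"
    by (simp add: lborel_distr_uminus)
  then show ?thesis
    using assms by (subst (asm) emeasure_distr) auto
qed

text \<open>For \<open>a \<in> A\<close> and \<open>b \<in> B\<close> the translates \<open>(A \<inter> {..a}) + b\<close> and \<open>a + (B \<inter> {b..})\<close> only
  meet in the point \<open>a + b\<close>.\<close>

lemma brunn_minkowski_real:
  fixes A B C :: "real set"
  assumes [measurable]: "A \<in> sets borel" "B \<in> sets borel" "C \<in> sets borel"
    and ne: "A \<noteq> {}" "B \<noteq> {}"
    and sum: "\<And>a b. a \<in> A \<Longrightarrow> b \<in> B \<Longrightarrow> a + b \<in> C"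
  shows "emeasure lborel A + emeasure lborel B \<le> emeasure lborel C"
proof -
  have half: "emeasure lborel (A \<inter> {..a}) + emeasure lborel (B \<inter> {b..}) \<le> emeasure lborel C"
    if ab: "a \<in> A" "b \<in> B" for a b
  proof -
    let ?X = "(\<lambda>x. x - b) -` (A \<inter> {..<a})" and ?Y = "(\<lambda>x. x - a) -` (B \<inter> {b..})"
    \<comment> \<open>Dropping the null set of one point makes the two translates disjoint: one lies
      strictly below \<open>a + b\<close>, the other at or above it.\<close>
    have "emeasure lborel (A \<inter> {..a}) = emeasure lborel (A \<inter> {..<a})"
    proof (rule emeasure_eq_AE)
      show "AE x in lborel. (x \<in> A \<inter> {..a}) = (x \<in> A \<inter> {..<a})"
        using AE_lborel_singleton[of a] by eventually_elim auto
    qed auto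
    then have "emeasure lborel (A \<inter> {..a}) + emeasure lborel (B \<inter> {b..})
        = emeasure lborel ?X + emeasure lborel ?Y"
      by (simp add: emeasure_lborel_translate del: vimage_Int)
    also have "\<dots> = emeasure lborel (?X \<union> ?Y)"
      by (rule plus_emeasure) (auto intro!: measurable_sets_borel[of _ borel])
    also have "\<dots> \<le> emeasure lborel C"
      using sum ab
      by (intro emeasure_mono) (force dest: sum[of "_ - b" b] sum[of a "_ - a"])+
    finally show ?thesis .
  qed
  define c where "c = emeasure lborel C"
  show ?thesis
  proof (cases "c = \<infinity>")
    case False
    \<comment> \<open>The pieces in \<open>half\<close> are enlarged one at a time: with
      \<open>a\<close> fixed, \<open>B\<close> is exhausted by its final segments, which reflection
      turns into initial ones; then \<open>A\<close> is exhausted.\<close>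
    have B: "emeasure lborel B \<le> c - emeasure lborel (A \<inter> {..a})" if a: "a \<in> A" for a
    proof -
      have "emeasure lborel (uminus -` B) \<le> c - emeasure lborel (A \<inter> {..a})"
      proof (rule emeasure_le_of_initial_segments)
        fix b assume "b \<in> uminus -` B"
        then have b: "- b \<in> B" by simp
        have "emeasure lborel (uminus -` B \<inter> {..b}) = emeasure lborel (uminus -` (B \<inter> {- b..}))"
          by (rule arg_cong[where f = "emeasure lborel"]) auto
        also have "\<dots> = emeasure lborel (B \<inter> {- b..})" by (simp add: emeasure_lborel_uminus del: vimage_Int)
        also have "\<dots> \<le> c - emeasure lborel (A \<inter> {..a})"
          using half[OF a b] unfolding c_def by (simp add: ennreal_le_minus_iff add.commute)
        finally show "emeasure lborel (uminus -` B \<inter> {..b}) \<le> c - emeasure lborel (A \<inter> {..a})" .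
      qed (use ne(2) in \<open>auto intro!: measurable_sets_borel[of _ borel] simp: ex_in_conv[symmetric] intro: exI[of _ "- _"]\<close>)
      then show ?thesis by (simp add: emeasure_lborel_uminus)
    qed
    \<comment> \<open>Subtraction truncates at 0, so \<open>x \<le> c - y\<close> yields
      \<open>x + y \<le> c\<close> only together with \<open>y \<le> c\<close>.\<close>
    have Ac: "emeasure lborel (A \<inter> {..a}) \<le> c" if "a \<in> A" for a
      using half[OF that] ne(2) unfolding c_def by (meson all_not_in_conv le_iff_add order_trans)
    have "emeasure lborel A \<le> c - emeasure lborel B"
    proof (rule emeasure_le_of_initial_segments)
      fix a assume a: "a \<in> A"
      have "emeasure lborel B + emeasure lborel (A \<inter> {..a}) \<le> c"
        using B[OF a] Ac[OF a] by (auto simp: ennreal_le_minus_iff)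
      then show "emeasure lborel (A \<inter> {..a}) \<le> c - emeasure lborel B"
        by (simp add: ennreal_le_minus_iff add.commute)
    qed (use ne in auto)
    moreover have "emeasure lborel B \<le> c"
      using B ne(1) by (meson all_not_in_conv diff_le_self_ennreal order_trans)
    ultimately show ?thesis
      unfolding c_def[symmetric]
      by (auto simp: ennreal_le_minus_iff add.commute)
  qed (simp add: c_def)
qed

section \<open>Superlevel sets and Prekopa--Leindler on the line\<close>

lemma ennreal_four_mult_le_square: "4 * (x * y) \<le> (x + y)\<^sup>2" for x y :: ennreal
proof (cases x; cases y)
  fix r s :: real assume rs: "x = ennreal r" "0 \<le> r" "y = ennreal s" "0 \<le> s"
  have "4 * (r * s) \<le> (r + s)\<^sup>2"
    using zero_le_power2[of "r - s"] by (simp add: power2_eq_square algebra_simps)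
  moreover have "4 * (x * y) = ennreal (4 * (r * s))"
    using rs by (simp add: ennreal_mult)
  moreover have "(x + y)\<^sup>2 = ennreal ((r + s)\<^sup>2)"
    using rs by (simp add: ennreal_power flip: ennreal_plus)
  ultimately show ?thesis by (simp add: ennreal_leI)
qed (auto simp: power2_eq_square ennreal_mult_top ennreal_top_mult)

text \<open>Layer-cake formula with the levels rescaled to the unit interval. After normalization by
  their own suprema, two functions of different heights can be compared at a common parameter
  \<open>t\<close>.\<close>

lemma nn_integral_level_sets:
  fixes u :: "real \<Rightarrow> ennreal"
  assumes [measurable]: "u \<in> borel_measurable borel" and a: "0 < a" and le: "\<And>x. u x \<le> ennreal a"
  shows "(\<integral>\<^sup>+x. u x \<partial>lborel)
       = ennreal a * (\<integral>\<^sup>+t. indicator {0<..<1} t * emeasure lborel {x. ennreal (a * t) < u x} \<partial>lborel)"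
proof -
  have "(\<integral>\<^sup>+x. u x \<partial>lborel)
      = (\<integral>\<^sup>+x. \<integral>\<^sup>+t. ennreal a * indicator {t. 0 < t \<and> t < 1 \<and> ennreal (a * t) < u x} t \<partial>lborel \<partial>lborel)"
  proof (rule nn_integral_cong)
    fix x
    obtain r where r: "u x = ennreal r" "0 \<le> r" "r \<le> a"
      using le[of x] a by (cases "u x") (auto simp: top_unique)
    have "t < 1" if "t * a < r" for t
    proof -
      have "t * a < 1 * a" using that r(3) by simp
      then show ?thesis by (simp only: mult_less_cancel_right_pos[OF a])
    qed
    then have "{t. 0 < t \<and> t < 1 \<and> ennreal (a * t) < u x} = {0<..<r / a}"
      using r a by (auto simp: ennreal_less_iff field_simps)
    moreover have "ennreal a * ennreal (r / a) = ennreal r"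
      using r a by (simp flip: ennreal_mult)
    ultimately show "u x = (\<integral>\<^sup>+t. ennreal a * indicator {t. 0 < t \<and> t < 1 \<and> ennreal (a * t) < u x} t \<partial>lborel)"
      using r a by (simp add: nn_integral_cmult)
  qed
  also have "\<dots> = (\<integral>\<^sup>+t. \<integral>\<^sup>+x. ennreal a * indicator {t. 0 < t \<and> t < 1 \<and> ennreal (a * t) < u x} t \<partial>lborel \<partial>lborel)"
    by (rule lborel_pair.Fubini') measurable
  also have "\<dots> = (\<integral>\<^sup>+t. ennreal a * (indicator {0<..<1} t * emeasure lborel {x. ennreal (a * t) < u x}) \<partial>lborel)"
  proof (rule nn_integral_cong)
    fix t :: real
    have "(\<integral>\<^sup>+x. ennreal a * indicator {t. 0 < t \<and> t < 1 \<and> ennreal (a * t) < u x} t \<partial>lborel)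
      = (\<integral>\<^sup>+x. ennreal a * indicator {0<..<1} t * indicator {x. ennreal (a * t) < u x} x \<partial>lborel)"
      by (intro nn_integral_cong) (auto simp: indicator_def)
    then show "(\<integral>\<^sup>+x. ennreal a * indicator {t. 0 < t \<and> t < 1 \<and> ennreal (a * t) < u x} t \<partial>lborel)
      = ennreal a * (indicator {0<..<1} t * emeasure lborel {x. ennreal (a * t) < u x})"
      by (simp add: nn_integral_cmult mult.assoc)
  qed
  also have "\<dots> = ennreal a * (\<integral>\<^sup>+t. indicator {0<..<1} t * emeasure lborel {x. ennreal (a * t) < u x} \<partial>lborel)"
    by (rule nn_integral_cmult) measurable
  finally show ?thesis .
qed

text \<open>Only an inequality, since \<open>w\<close> may exceed \<open>s\<close> and the levels
  below \<open>s\<close> miss that excess. The level sets are weak ones because the product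
  hypothesis of Prekopa--Leindler is a weak inequality.\<close>

lemma nn_integral_level_sets_le:
  fixes w :: "real \<Rightarrow> ennreal"
  assumes [measurable]: "w \<in> borel_measurable borel" and s: "0 < s"
  shows "ennreal s * (\<integral>\<^sup>+t. indicator {0<..<1} t * emeasure lborel {x. ennreal (s * t) \<le> w x} \<partial>lborel)
       \<le> (\<integral>\<^sup>+x. w x \<partial>lborel)"
proof -
  have "ennreal s * (\<integral>\<^sup>+t. indicator {0<..<1} t * emeasure lborel {x. ennreal (s * t) \<le> w x} \<partial>lborel)
      = (\<integral>\<^sup>+t. ennreal s * (indicator {0<..<1} t * emeasure lborel {x. ennreal (s * t) \<le> w x}) \<partial>lborel)"
    by (rule nn_integral_cmult[symmetric]) measurable
  also have "\<dots> = (\<integral>\<^sup>+t. \<integral>\<^sup>+x. ennreal s * indicator {t. 0 < t \<and> t < 1 \<and> ennreal (s * t) \<le> w x} t \<partial>lborel \<partial>lborel)"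
  proof (rule nn_integral_cong)
    fix t :: real
    have "(\<integral>\<^sup>+x. ennreal s * indicator {t. 0 < t \<and> t < 1 \<and> ennreal (s * t) \<le> w x} t \<partial>lborel)
      = (\<integral>\<^sup>+x. ennreal s * indicator {0<..<1} t * indicator {x. ennreal (s * t) \<le> w x} x \<partial>lborel)"
      by (intro nn_integral_cong) (auto simp: indicator_def)
    then show "ennreal s * (indicator {0<..<1} t * emeasure lborel {x. ennreal (s * t) \<le> w x})
      = (\<integral>\<^sup>+x. ennreal s * indicator {t. 0 < t \<and> t < 1 \<and> ennreal (s * t) \<le> w x} t \<partial>lborel)"
      by (simp add: nn_integral_cmult mult.assoc)
  qed
  also have "\<dots> = (\<integral>\<^sup>+x. \<integral>\<^sup>+t. ennreal s * indicator {t. 0 < t \<and> t < 1 \<and> ennreal (s * t) \<le> w x} t \<partial>lborel \<partial>lborel)"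
    by (rule lborel_pair.Fubini') measurable
  also have "\<dots> \<le> (\<integral>\<^sup>+x. w x \<partial>lborel)"
  proof (rule nn_integral_mono)
    fix x
    show "(\<integral>\<^sup>+t. ennreal s * indicator {t. 0 < t \<and> t < 1 \<and> ennreal (s * t) \<le> w x} t \<partial>lborel) \<le> w x"
    proof (cases "w x")
      case (real r)
      have "{t. 0 < t \<and> t < 1 \<and> ennreal (s * t) \<le> w x} \<subseteq> {0..r / s}"
        using real s by (auto simp: field_simps)
      then have "emeasure lborel {t. 0 < t \<and> t < 1 \<and> ennreal (s * t) \<le> w x} \<le> ennreal (r / s)"
        using real s by (metis atLeastAtMost_borel diff_zero divide_nonneg_pos emeasure_lborel_Icc emeasure_mono sets_lborel)
      then have "ennreal s * emeasure lborel {t. 0 < t \<and> t < 1 \<and> ennreal (s * t) \<le> w x} \<le> ennreal s * ennreal (r / s)"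
        by (rule mult_left_mono) simp
      also have "\<dots> = w x"
        using real s by (simp flip: ennreal_mult)
      finally show ?thesis by (simp add: nn_integral_cmult)
    qed simp
  qed
  finally show ?thesis .
qed

text \<open>Brunn--Minkowski for the superlevel sets of \<open>u\<close>, \<open>v\<close>, relative to the suprema of the two
  functions, so that both sets are nonempty at every level \<open>t < 1\<close>.\<close>

lemma prekopa_leindler_real_bounded:
  fixes u v w :: "real \<Rightarrow> ennreal"
  assumes [measurable]: "u \<in> borel_measurable borel" "v \<in> borel_measurable borel"
      "w \<in> borel_measurable borel"
    and le: "\<And>x y. u x * v y \<le> (w ((x + y) / 2))\<^sup>2"
    and bd: "\<And>x. u x \<le> ennreal cu" "\<And>x. v x \<le> ennreal cv"
  shows "(\<integral>\<^sup>+x. u x \<partial>lborel) * (\<integral>\<^sup>+x. v x \<partial>lborel) \<le> (\<integral>\<^sup>+x. w x \<partial>lborel)\<^sup>2"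
proof (cases "(SUP x. u x) = 0 \<or> (SUP x. v x) = 0")
  case True
  then have "(\<forall>x. u x = 0) \<or> (\<forall>x. v x = 0)"
    by (auto simp flip: bot_ennreal simp: SUP_eq_iff SUP_bot_conv)
  then show ?thesis by auto
next
  case False
  have fin: "(SUP x. u x) \<noteq> top" "(SUP x. v x) \<noteq> top"
    using SUP_least[of UNIV u, OF bd(1)] SUP_least[of UNIV v, OF bd(2)] neq_top_trans[OF ennreal_neq_top]
    by blast+
  obtain a where a: "(SUP x. u x) = ennreal a" "0 < a"
    using fin(1) False by (cases "SUP x. u x") (auto simp: less_le)
  obtain b where b: "(SUP x. v x) = ennreal b" "0 < b"
    using fin(2) False by (cases "SUP x. v x") (auto simp: less_le)
  \<comment> \<open>With the geometric mean, \<open>(s * t)\<^sup>2\<close> is the product of the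
    levels \<open>a * t\<close> and \<open>b * t\<close>, so two points above these have a midpoint
    at which \<open>w\<close> reaches \<open>s * t\<close>.\<close>
  define s where "s = sqrt (a * b)"
  have s: "0 < s" "s * s = a * b" using a b by (auto simp: s_def)
  define X where "X = (\<integral>\<^sup>+t. indicator {0<..<1} t * emeasure lborel {x. ennreal (a * t) < u x} \<partial>lborel)"
  define Y where "Y = (\<integral>\<^sup>+t. indicator {0<..<1} t * emeasure lborel {x. ennreal (b * t) < v x} \<partial>lborel)"
  have uX: "(\<integral>\<^sup>+x. u x \<partial>lborel) = ennreal a * X"
    unfolding X_def using a by (intro nn_integral_level_sets) (auto intro: SUP_upper simp flip: a(1))
  have vY: "(\<integral>\<^sup>+x. v x \<partial>lborel) = ennreal b * Y"
    unfolding Y_def using b by (intro nn_integral_level_sets) (auto intro: SUP_upper simp flip: b(1))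
  \<comment> \<open>Using \<open>w (x / 2)\<close> turns midpoints into sums, as Brunn--Minkowski
    wants them. The dilation costs a factor 2, which is squared in the end and cancels against the 4
    of the arithmetic-geometric mean inequality.\<close>
  have lev: "emeasure lborel {x. ennreal (a * t) < u x} + emeasure lborel {x. ennreal (b * t) < v x}
      \<le> emeasure lborel {x. ennreal (s * t) \<le> w (x / 2)}" if t: "0 < t" "t < 1" for t
  proof (rule brunn_minkowski_real)
    have "ennreal (a * t) < (SUP x. u x)" "ennreal (b * t) < (SUP x. v x)"
      using a b t by (auto simp: ennreal_less_iff)
    then show "{x. ennreal (a * t) < u x} \<noteq> {}" "{x. ennreal (b * t) < v x} \<noteq> {}"
      by (auto simp: less_SUP_iff)
    fix x y assume xy: "x \<in> {x. ennreal (a * t) < u x}" "y \<in> {x. ennreal (b * t) < v x}"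
    have "(ennreal (s * t))\<^sup>2 = ennreal (a * t) * ennreal (b * t)"
      using s a b t by (simp add: ennreal_power flip: ennreal_mult) (simp add: power2_eq_square algebra_simps)
    also have "\<dots> \<le> u x * v y"
      using xy by (intro mult_mono) auto
    also have "\<dots> \<le> (w ((x + y) / 2))\<^sup>2" by (rule le)
    finally have *: "(ennreal (s * t))\<^sup>2 \<le> (w ((x + y) / 2))\<^sup>2" .
    have "ennreal (s * t) \<le> w ((x + y) / 2)"
    proof (cases "w ((x + y) / 2)")
      case (real r)
      with * show ?thesis
        using s t by (auto simp: ennreal_power intro!: ennreal_leI dest: power2_le_imp_le)
    qed simp
    then show "x + y \<in> {x. ennreal (s * t) \<le> w (x / 2)}" by simp
  qed measurable
  have "X + Y = (\<integral>\<^sup>+t. indicator {0<..<1} t * emeasure lborel {x. ennreal (a * t) < u x}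
        + indicator {0<..<1} t * emeasure lborel {x. ennreal (b * t) < v x} \<partial>lborel)"
    unfolding X_def Y_def by (rule nn_integral_add[symmetric]) measurable
  also have "\<dots> \<le> (\<integral>\<^sup>+t. indicator {0<..<1} t * emeasure lborel {x. ennreal (s * t) \<le> w (x / 2)} \<partial>lborel)"
    using lev by (intro nn_integral_mono) (auto simp: indicator_def)
  finally have "ennreal s * (X + Y) \<le> ennreal s * \<dots>"
    by (rule mult_left_mono) simp
  also have "\<dots> \<le> (\<integral>\<^sup>+x. w (x / 2) \<partial>lborel)"
    using s by (intro nn_integral_level_sets_le) auto
  also have "\<dots> = 2 * (\<integral>\<^sup>+x. w x \<partial>lborel)"
    by (subst nn_integral_real_affine[of _ 2 0]) auto
  finally have main: "ennreal s * (X + Y) \<le> 2 * (\<integral>\<^sup>+x. w x \<partial>lborel)" .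
  have "4 * ((\<integral>\<^sup>+x. u x \<partial>lborel) * (\<integral>\<^sup>+x. v x \<partial>lborel)) = (ennreal a * ennreal b) * (4 * (X * Y))"
    by (simp add: uX vY mult_ac)
  also have "ennreal a * ennreal b = (ennreal s)\<^sup>2"
    using s a b by (simp add: ennreal_power power2_eq_square flip: ennreal_mult)
  also have "(ennreal s)\<^sup>2 * (4 * (X * Y)) \<le> (ennreal s)\<^sup>2 * (X + Y)\<^sup>2"
    by (intro mult_left_mono ennreal_four_mult_le_square) simp
  also have "\<dots> \<le> (2 * (\<integral>\<^sup>+x. w x \<partial>lborel))\<^sup>2"
    using main by (subst power_mult_distrib[symmetric]) (intro power_mono, auto)
  finally have "4 * ((\<integral>\<^sup>+x. u x \<partial>lborel) * (\<integral>\<^sup>+x. v x \<partial>lborel)) \<le> 4 * (\<integral>\<^sup>+x. w x \<partial>lborel)\<^sup>2"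
    by (simp add: power_mult_distrib)
  then show ?thesis
    by (subst (asm) ennreal_mult_le_mult_iff) auto
qed

lemma nn_integral_min_of_nat:
  assumes [measurable]: "u \<in> borel_measurable M"
  shows "(\<integral>\<^sup>+x. u x \<partial>M) = (SUP n. \<integral>\<^sup>+x. min (u x) (of_nat n) \<partial>M)"
proof -
  have "u x = (SUP n. min (u x) (of_nat n))" for x
  proof (rule antisym)
    show "u x \<le> (SUP n. min (u x) (of_nat n))"
    proof (cases "u x")
      case (real r)
      obtain n where "r \<le> real n" using real_arch_simple by blast
      then have "u x \<le> of_nat n"
        using real by (simp add: ennreal_of_nat_eq_real_of_nat ennreal_leI)
      then show ?thesis by (intro SUP_upper2[of n]) auto
    next
      case top
      then show ?thesis by (simp add: min_def top_unique ennreal_SUP_of_nat_eq_top)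
    qed
  qed (auto intro: SUP_least)
  then have "(\<integral>\<^sup>+x. u x \<partial>M) = (\<integral>\<^sup>+x. (SUP n. min (u x) (of_nat n)) \<partial>M)"
    by (intro nn_integral_cong) blast
  also have "\<dots> = (SUP n. \<integral>\<^sup>+x. min (u x) (of_nat n) \<partial>M)"
    by (intro nn_integral_monotone_convergence_SUP)
       (auto simp: incseq_def le_fun_def intro: min.coboundedI2 of_nat_mono)
  finally show ?thesis .
qed

text \<open>Truncating \<open>u\<close> and \<open>v\<close> only shrinks the left side of the
  hypothesis, so the bounded case applies to every pair of truncations; monotone convergence does
  the rest.\<close>

lemma prekopa_leindler_real:
  fixes u v w :: "real \<Rightarrow> ennreal"
  assumes [measurable]: "u \<in> borel_measurable borel" "v \<in> borel_measurable borel"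
      "w \<in> borel_measurable borel"
    and le: "\<And>x y. u x * v y \<le> (w ((x + y) / 2))\<^sup>2"
  shows "(\<integral>\<^sup>+x. u x \<partial>lborel) * (\<integral>\<^sup>+x. v x \<partial>lborel) \<le> (\<integral>\<^sup>+x. w x \<partial>lborel)\<^sup>2"
proof -
  have "(\<integral>\<^sup>+x. min (u x) (of_nat k) \<partial>lborel) * (\<integral>\<^sup>+x. min (v x) (of_nat l) \<partial>lborel)
      \<le> (\<integral>\<^sup>+x. w x \<partial>lborel)\<^sup>2" for k l
  proof (rule prekopa_leindler_real_bounded[where cu = "real k" and cv = "real l"])
    fix x y show "min (u x) (of_nat k) * min (v y) (of_nat l) \<le> (w ((x + y) / 2))\<^sup>2"
      by (intro order_trans[OF mult_mono le]) auto
  qed (auto simp: ennreal_of_nat_eq_real_of_nat)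
  then show ?thesis
    by (auto simp: nn_integral_min_of_nat[of u] nn_integral_min_of_nat[of v]
        SUP_mult_right_ennreal SUP_mult_left_ennreal intro!: SUP_least)
qed

text \<open>Tensorization. With all coordinates but one fixed, the inequality on the line says
  exactly that the fibre integrals of \<open>u\<close>, \<open>v\<close>, \<open>w\<close> satisfy
  the midpoint hypothesis in the remaining coordinates. The midpoint is restricted to
  \<open>I\<close> because points of the product space are undefined outside
  \<open>I\<close>.\<close>

lemma prekopa_leindler_PiM:
  fixes u v w :: "('i \<Rightarrow> real) \<Rightarrow> ennreal"
  assumes "finite I"
    and "u \<in> borel_measurable (\<Pi>\<^sub>M i\<in>I. lborel)" "v \<in> borel_measurable (\<Pi>\<^sub>M i\<in>I. lborel)"
      "w \<in> borel_measurable (\<Pi>\<^sub>M i\<in>I. lborel)"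
    and "\<And>x y. x \<in> space (\<Pi>\<^sub>M i\<in>I. lborel) \<Longrightarrow> y \<in> space (\<Pi>\<^sub>M i\<in>I. lborel) \<Longrightarrow>
           u x * v y \<le> (w (\<lambda>i\<in>I. (x i + y i) / 2))\<^sup>2"
  shows "(\<integral>\<^sup>+x. u x \<partial>(\<Pi>\<^sub>M i\<in>I. lborel)) * (\<integral>\<^sup>+x. v x \<partial>(\<Pi>\<^sub>M i\<in>I. lborel))
       \<le> (\<integral>\<^sup>+x. w x \<partial>(\<Pi>\<^sub>M i\<in>I. lborel))\<^sup>2"
  using assms
proof (induction I arbitrary: u v w rule: finite_induct)
  case empty
  interpret product_sigma_finite "\<lambda>_::'i. lborel :: real measure" by standard
  show ?case
    using empty.prems(4)[of "\<lambda>_. undefined" "\<lambda>_. undefined"]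
    by (simp add: nn_integral_empty space_PiM restrict_def)
next
  case (insert i I)
  interpret product_sigma_finite "\<lambda>_::'i. lborel :: real measure" by standard
  note [measurable] = insert.prems(1-3)
  interpret I: finite_product_sigma_finite "\<lambda>_::'i. lborel :: real measure" I
    by standard fact
  have fiber: "(\<lambda>x. \<integral>\<^sup>+t. h (x(i := t)) \<partial>lborel) \<in> borel_measurable (\<Pi>\<^sub>M i\<in>I. lborel)"
    if [measurable]: "h \<in> borel_measurable (\<Pi>\<^sub>M i\<in>insert i I. lborel)"
    for h :: "('i \<Rightarrow> real) \<Rightarrow> ennreal"
    by measurable
  have line: "(\<lambda>t. h (x(i := t))) \<in> borel_measurable borel"
    if [measurable]: "h \<in> borel_measurable (\<Pi>\<^sub>M i\<in>insert i I. lborel)"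
      and x: "x \<in> space (\<Pi>\<^sub>M i\<in>I. lborel)"
    for h :: "('i \<Rightarrow> real) \<Rightarrow> ennreal" and x
  proof -
    have "(\<lambda>t. x(i := t)) \<in> measurable lborel (\<Pi>\<^sub>M i\<in>insert i I. lborel)"
      using x by (intro measurable_fun_upd[where J = I]) auto
    from measurable_compose[OF this that(1)] show ?thesis by simp
  qed
  have "(\<integral>\<^sup>+x. (\<integral>\<^sup>+t. u (x(i := t)) \<partial>lborel) \<partial>(\<Pi>\<^sub>M i\<in>I. lborel))
      * (\<integral>\<^sup>+x. (\<integral>\<^sup>+t. v (x(i := t)) \<partial>lborel) \<partial>(\<Pi>\<^sub>M i\<in>I. lborel))
      \<le> (\<integral>\<^sup>+x. (\<integral>\<^sup>+t. w (x(i := t)) \<partial>lborel) \<partial>(\<Pi>\<^sub>M i\<in>I. lborel))\<^sup>2"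
  proof (rule insert.IH)
    fix x y assume x: "x \<in> space (\<Pi>\<^sub>M i\<in>I. lborel :: real measure)"
      and y: "y \<in> space (\<Pi>\<^sub>M i\<in>I. lborel :: real measure)"
    have z: "(\<lambda>j\<in>I. (x j + y j) / 2) \<in> space (\<Pi>\<^sub>M i\<in>I. lborel :: real measure)"
      by (simp add: space_PiM)
    show "(\<integral>\<^sup>+t. u (x(i := t)) \<partial>lborel) * (\<integral>\<^sup>+t. v (y(i := t)) \<partial>lborel)
        \<le> (\<integral>\<^sup>+t. w ((\<lambda>j\<in>I. (x j + y j) / 2)(i := t)) \<partial>lborel)\<^sup>2"
    proof (intro prekopa_leindler_real line x y z)
      fix s t :: real
      have eq: "(\<lambda>j\<in>insert i I. ((x(i := s)) j + (y(i := t)) j) / 2) = (\<lambda>j\<in>I. (x j + y j) / 2)(i := (s + t) / 2)"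
        using insert.hyps(2) by (auto simp: restrict_def fun_eq_iff)
      have "x(i := s) \<in> space (\<Pi>\<^sub>M i\<in>insert i I. lborel)" "y(i := t) \<in> space (\<Pi>\<^sub>M i\<in>insert i I. lborel)"
        using x y by (auto simp: space_PiM PiE_fun_upd)
      from insert.prems(4)[OF this]
      show "u (x(i := s)) * v (y(i := t)) \<le> (w ((\<lambda>j\<in>I. (x j + y j) / 2)(i := (s + t) / 2)))\<^sup>2"
        by (simp only: eq)
    qed measurable
  qed (intro fiber; measurable)+
  then show ?case
    using insert.hyps by (simp add: product_nn_integral_insert)
qed

theorem prekopa_leindler:
  fixes u v w :: "'a::euclidean_space \<Rightarrow> ennreal"
  assumes [measurable]: "u \<in> borel_measurable borel" "v \<in> borel_measurable borel"
      "w \<in> borel_measurable borel"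
    and le: "\<And>x y. u x * v y \<le> (w ((1 / 2) *\<^sub>R (x + y)))\<^sup>2"
  shows "(\<integral>\<^sup>+x. u x \<partial>lborel) * (\<integral>\<^sup>+x. v x \<partial>lborel) \<le> (\<integral>\<^sup>+x. w x \<partial>lborel)\<^sup>2"
proof -
  let ?P = "\<Pi>\<^sub>M b\<in>(Basis :: 'a set). lborel :: real measure"
  let ?T = "\<lambda>f. \<Sum>b\<in>(Basis :: 'a set). f b *\<^sub>R b"
  have T [measurable]: "?T \<in> borel_measurable ?P" by measurable
  have *: "(\<integral>\<^sup>+x. h x \<partial>lborel) = (\<integral>\<^sup>+f. h (?T f) \<partial>?P)"
    if "h \<in> borel_measurable borel" for h :: "'a \<Rightarrow> ennreal"
    by (subst lborel_eq) (simp add: nn_integral_distr that)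
  have "(\<integral>\<^sup>+f. u (?T f) \<partial>?P) * (\<integral>\<^sup>+f. v (?T f) \<partial>?P) \<le> (\<integral>\<^sup>+f. w (?T f) \<partial>?P)\<^sup>2"
  proof (rule prekopa_leindler_PiM)
    fix x y :: "'a \<Rightarrow> real"
    have "?T (\<lambda>b\<in>Basis. (x b + y b) / 2) = (1 / 2) *\<^sub>R (?T x + ?T y)"
    proof -
      have "?T (\<lambda>b\<in>Basis. (x b + y b) / 2) = (\<Sum>b\<in>Basis. (1 / 2) *\<^sub>R (x b *\<^sub>R b + y b *\<^sub>R b))"
        by (intro sum.cong) (auto simp: scaleR_add_left add_divide_distrib scaleR_add_right)
      then show ?thesis by (simp only: scaleR_sum_right[symmetric] sum.distrib)
    qed
    then show "u (?T x) * v (?T y) \<le> (w (?T (\<lambda>b\<in>Basis. (x b + y b) / 2)))\<^sup>2"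
      using le[of "?T x" "?T y"] by simp
  qed (auto intro: measurable_compose[OF T])
  then show ?thesis by (simp add: *)
qed

subsection \<open>The Poincare inequality\<close>

text \<open>The Lagrange remainder of order four is nonnegative for either sign of \<open>t\<close>.
  Stopping after the cubic term keeps the quadratic coefficient exact, and this coefficient becomes
  the variance.\<close>

lemma exp_ge_cubic: "1 + t + t\<^sup>2 / 2 + t ^ 3 / 6 \<le> exp t" for t :: real
proof -
  obtain s where "exp t = (\<Sum>k<4. t ^ k / fact k) + exp s / fact 4 * t ^ 4"
    using Maclaurin_exp_le[of t 4] by blast
  moreover have "(\<Sum>k<4. t ^ k / fact k) = 1 + t + t\<^sup>2 / 2 + t ^ 3 / 6"
    by (simp add: eval_nat_numeral fact_reduce)
  moreover have "0 \<le> exp s / fact 4 * t ^ 4"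
    by (intro mult_nonneg_nonneg) auto
  ultimately show ?thesis by linarith
qed

text \<open>For \<open>t = e * g - e\<^sup>2 * c * G\<close> the error is uniform of order
  \<open>e ^ 3\<close>: the summand \<open>b * B\<^sup>2\<close> absorbs the cross term in the
  square of \<open>t\<close>, and the other summand comes from the cubic term via
  \<open>\<bar>t\<bar> \<le> e * (B + b * B)\<close>. The number \<open>c\<close> will depend on
  \<open>e\<close>; only its bound \<open>b\<close> may enter the error.\<close>

lemma exp_perturbation_ge:
  fixes e g G c B b :: real
  assumes e: "0 \<le> e" "e \<le> 1" and g: "\<bar>g\<bar> \<le> B" and G: "0 \<le> G" "G \<le> B" and c: "0 \<le> c" "c \<le> b"
  shows "1 + e * g - e\<^sup>2 * c * G + e\<^sup>2 * g\<^sup>2 / 2 - (b * B\<^sup>2 + (B + b * B) ^ 3 / 6) * e ^ 3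
       \<le> exp (e * g - e\<^sup>2 * c * G)"
proof -
  define t where "t = e * g - e\<^sup>2 * c * G"
  define L where "L = B + b * B"
  have B: "0 \<le> B" using g by linarith
  have cG: "0 \<le> c * G" "c * G \<le> b * B" using c G by (auto intro: mult_mono)
  have "\<bar>t\<bar> \<le> \<bar>e * g\<bar> + \<bar>e\<^sup>2 * (c * G)\<bar>"
    unfolding t_def mult.assoc by (rule abs_triangle_ineq4)
  also have "\<dots> \<le> e * B + e * (b * B)"
  proof (intro add_mono)
    show "\<bar>e * g\<bar> \<le> e * B" using e g by (simp add: abs_mult mult_left_mono)
    have "e\<^sup>2 * (c * G) \<le> e * (b * B)"
      using e cG by (intro mult_mono'[where a = "e\<^sup>2" and b = e]) (auto simp: power2_eq_square mult_left_le simp del: mult_nonneg_nonneg)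
    then show "\<bar>e\<^sup>2 * (c * G)\<bar> \<le> e * (b * B)" using cG by simp
  qed
  finally have t: "\<bar>t\<bar> \<le> e * L" by (simp add: L_def algebra_simps)
  have "\<bar>t ^ 3\<bar> \<le> (e * L) ^ 3"
    using power_mono[OF t, of 3] by (simp add: power_abs)
  then have t3: "- (L ^ 3 * e ^ 3) \<le> t ^ 3"
    by (simp add: power_mult_distrib mult.commute)
  have "g * (c * G) \<le> \<bar>g\<bar> * (c * G)"
    using cG by (intro mult_right_mono) auto
  also have "\<dots> \<le> B * (b * B)"
    by (rule mult_mono) (use cG g B in auto)
  finally have gcG: "g * (c * G) \<le> B * (b * B)" .
  have "t\<^sup>2 = e\<^sup>2 * g\<^sup>2 - 2 * e ^ 3 * (g * (c * G)) + (e\<^sup>2 * c * G)\<^sup>2"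
    unfolding t_def by (simp add: power2_eq_square power3_eq_cube algebra_simps)
  moreover have "e ^ 3 * (g * (c * G)) \<le> e ^ 3 * (B * (b * B))"
    using e gcG by (intro mult_left_mono) auto
  ultimately have t2: "e\<^sup>2 * g\<^sup>2 - 2 * e ^ 3 * (b * B\<^sup>2) \<le> t\<^sup>2"
    using zero_le_power2[of "e\<^sup>2 * c * G"] unfolding power2_eq_square[of B] mult.left_commute[of b B]
    by linarith
  have "1 + t + t\<^sup>2 / 2 + t ^ 3 / 6 \<le> exp t" by (rule exp_ge_cubic)
  then show ?thesis
    using t2 t3 unfolding t_def[symmetric] L_def[symmetric]
    by (simp add: t_def[symmetric] algebra_simps) (simp add: t_def algebra_simps)
qed

lemma integrable_bounded_AE:
  fixes h :: "'a \<Rightarrow> real"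
  assumes "finite_measure M" "h \<in> borel_measurable M" "AE x in M. \<bar>h x\<bar> \<le> B"
  shows "integrable M h"
  using assms by (intro finite_measure.integrable_const_bound[where B = B]) auto

text \<open>The hypothesis is an infinitesimal form of the infimum-convolution inequality; the
  claim is its second-order expansion at \<open>\<epsilon> = 0\<close>.\<close>

lemma variance_le_of_exp_inequality:
  fixes g G :: "'a \<Rightarrow> real"
  assumes M: "finite_measure M"
    and meas [measurable]: "g \<in> borel_measurable M" "G \<in> borel_measurable M"
    and g: "AE x in M. \<bar>g x\<bar> \<le> B" and G: "AE x in M. 0 \<le> G x \<and> G x \<le> B"
    and l: "0 < l"
    and ineq: "\<And>e. 0 < e \<Longrightarrow> 2 * e * K < l \<Longrightarrow>
      (\<integral>x. exp (e * g x - e\<^sup>2 * (1 / (l - 2 * e * K)) * G x) \<partial>M) * (\<integral>x. exp (- (e * g x)) \<partial>M)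
        \<le> (measure M (space M))\<^sup>2"
  shows "measure M (space M) * (\<integral>x. (g x)\<^sup>2 \<partial>M) - (\<integral>x. g x \<partial>M)\<^sup>2
      \<le> measure M (space M) / l * (\<integral>x. G x \<partial>M)"
proof -
  interpret finite_measure M by fact
  define Z where "Z = measure M (space M)"
  define m where "m = (\<integral>x. g x \<partial>M)"
  define s where "s = (\<integral>x. (g x)\<^sup>2 \<partial>M)"
  define G1 where "G1 = (\<integral>x. G x \<partial>M)"
  \<comment> \<open>Any number above the limit \<open>1 / l\<close> of \<open>c e\<close> would do
    as a bound for small \<open>e\<close>.\<close>
  define b where "b = 2 / l"
  define C where "C = b * B\<^sup>2 + (B + b * B) ^ 3 / 6"
  define c where "c e = 1 / (l - 2 * e * K)" for e
  \<comment> \<open>\<open>p\<close> and \<open>q\<close> are the second-order coefficients: the two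
    integrals are at least \<open>Z + e * m + e\<^sup>2 * p e\<close> and
    \<open>Z - e * m + e\<^sup>2 * q e\<close>. In their product the first-order terms cancel and
    \<open>Z\<^sup>2\<close> matches the right-hand side, so what is left can be divided by
    \<open>e\<^sup>2\<close>.\<close>
  define p where "p e = s / 2 - c e * G1 - C * Z * e" for e
  define q where "q e = s / 2 - C * Z * e" for e
  have int: "integrable M g" "integrable M (\<lambda>x. (g x)\<^sup>2)" "integrable M G"
  proof -
    show "integrable M g" using g by (intro integrable_bounded_AE[OF M]) auto
    show "integrable M G" using G by (intro integrable_bounded_AE[OF M]) auto
    have "AE x in M. \<bar>(g x)\<^sup>2\<bar> \<le> B\<^sup>2"
      using g by eventually_elim (metis abs_ge_zero abs_power2 power2_abs power_mono)
    then show "integrable M (\<lambda>x. (g x)\<^sup>2)" by (intro integrable_bounded_AE[OF M]) auto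
  qed
  show ?thesis
  proof (cases "Z = 0")
    case True
    then show ?thesis by (simp add: Z_def)
  next
    case False
    then have Z: "0 < Z" by (simp add: Z_def zero_less_measure_iff)
    have clim: "(c \<longlongrightarrow> 1 / l) (at_right 0)"
      unfolding c_def using l by (auto intro!: tendsto_eq_intros)
    have plim: "(p \<longlongrightarrow> s / 2 - 1 / l * G1) (at_right 0)"
      unfolding p_def by (auto intro!: tendsto_eq_intros clim)
    have qlim: "(q \<longlongrightarrow> s / 2) (at_right 0)"
      unfolding q_def by (auto intro!: tendsto_eq_intros)
    \<comment> \<open>The last condition allows the two lower bounds to be multiplied. One positive
      factor is enough, because the integral replacing it on the other side is nonnegative
      anyway.\<close>
    have small: "\<forall>\<^sub>F e in at_right 0. 0 < e \<and> e \<le> 1 \<and> 2 * e * K < l \<and> 0 \<le> c e \<and> c e \<le> b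
        \<and> 0 < Z + e * m + e\<^sup>2 * p e"
    proof (intro eventually_conj)
      show "\<forall>\<^sub>F e in at_right (0::real). 0 < e" by (rule eventually_at_right_less)
      show "\<forall>\<^sub>F e in at_right (0::real). e \<le> 1"
        by (rule eventually_at_rightI[of 0 1]) auto
      have "((\<lambda>e. 2 * e * K) \<longlongrightarrow> 0) (at_right 0)" by (auto intro!: tendsto_eq_intros)
      from order_tendstoD(2)[OF this l] show "\<forall>\<^sub>F e in at_right 0. 2 * e * K < l" .
      have "0 < 1 / l" "1 / l < b" using l by (auto simp: b_def field_simps)
      then have "\<forall>\<^sub>F e in at_right 0. 0 < c e" "\<forall>\<^sub>F e in at_right 0. c e < b"
        by (auto intro: order_tendstoD[OF clim])
      then show "\<forall>\<^sub>F e in at_right 0. 0 \<le> c e" "\<forall>\<^sub>F e in at_right 0. c e \<le> b"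
        by (auto elim: eventually_mono)
      have "((\<lambda>e. Z + e * m + e\<^sup>2 * p e) \<longlongrightarrow> Z) (at_right 0)"
        by (auto intro!: tendsto_eq_intros plim)
      from order_tendstoD(1)[OF this Z] show "\<forall>\<^sub>F e in at_right 0. 0 < Z + e * m + e\<^sup>2 * p e" .
    qed
    have "\<forall>\<^sub>F e in at_right 0. - m\<^sup>2 + Z * (p e + q e) + e * m * (q e - p e) + e\<^sup>2 * (p e * q e) \<le> 0"
      using small
    proof eventually_elim
      fix e assume e: "0 < e \<and> e \<le> 1 \<and> 2 * e * K < l \<and> 0 \<le> c e \<and> c e \<le> b \<and> 0 < Z + e * m + e\<^sup>2 * p e"
      have B: "AE x in M. \<bar>e * g x\<bar> \<le> B"
        using g by eventually_elim (use e mult_mono[of e 1] in \<open>force simp: abs_mult\<close>)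
      have I: "Z + e * m + e\<^sup>2 * p e \<le> (\<integral>x. exp (e * g x - e\<^sup>2 * c e * G x) \<partial>M)"
      proof -
        have "Z + e * m + e\<^sup>2 * p e
            = (\<integral>x. 1 + e * g x - e\<^sup>2 * c e * G x + e\<^sup>2 * (g x)\<^sup>2 / 2 - C * e ^ 3 \<partial>M)"
          using int by (simp add: m_def s_def G1_def p_def Z_def power2_eq_square power3_eq_cube algebra_simps)
        also have "\<dots> \<le> (\<integral>x. exp (e * g x - e\<^sup>2 * c e * G x) \<partial>M)"
        proof (rule integral_mono_AE)
          show "integrable M (\<lambda>x. exp (e * g x - e\<^sup>2 * c e * G x))"
          proof (rule integrable_bounded_AE[OF M])
            show "AE x in M. \<bar>exp (e * g x - e\<^sup>2 * c e * G x)\<bar> \<le> exp B"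
              using B G
            proof eventually_elim
              fix x assume *: "\<bar>e * g x\<bar> \<le> B" "0 \<le> G x \<and> G x \<le> B"
              then have "0 \<le> e\<^sup>2 * c e * G x" using e by simp
              with * show "\<bar>exp (e * g x - e\<^sup>2 * c e * G x)\<bar> \<le> exp B" by simp
            qed
          qed measurable
          show "AE x in M. 1 + e * g x - e\<^sup>2 * c e * G x + e\<^sup>2 * (g x)\<^sup>2 / 2 - C * e ^ 3
              \<le> exp (e * g x - e\<^sup>2 * c e * G x)"
            using g G by eventually_elim (use e exp_perturbation_ge[of e] in \<open>auto simp: C_def\<close>)
        qed (use int in auto)
        finally show ?thesis .
      qed
      have J: "Z - e * m + e\<^sup>2 * q e \<le> (\<integral>x. exp (- (e * g x)) \<partial>M)"
      proof -
        have "Z - e * m + e\<^sup>2 * q e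
            = (\<integral>x. 1 - e * g x + e\<^sup>2 * (g x)\<^sup>2 / 2 - C * e ^ 3 \<partial>M)"
          using int by (simp add: m_def s_def q_def Z_def power2_eq_square power3_eq_cube algebra_simps)
        also have "\<dots> \<le> (\<integral>x. exp (- (e * g x)) \<partial>M)"
        proof (rule integral_mono_AE)
          show "integrable M (\<lambda>x. exp (- (e * g x)))"
          proof (rule integrable_bounded_AE[OF M])
            show "AE x in M. \<bar>exp (- (e * g x))\<bar> \<le> exp B"
              using B by eventually_elim auto
          qed measurable
          show "AE x in M. 1 - e * g x + e\<^sup>2 * (g x)\<^sup>2 / 2 - C * e ^ 3 \<le> exp (- (e * g x))"
            using g
          proof eventually_elim
            fix x assume "\<bar>g x\<bar> \<le> B"
            then show "1 - e * g x + e\<^sup>2 * (g x)\<^sup>2 / 2 - C * e ^ 3 \<le> exp (- (e * g x))"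
              using e exp_perturbation_ge[of e "- g x" B 0 0 b] by (auto simp: C_def)
          qed
        qed (use int in auto)
        finally show ?thesis .
      qed
      have "(Z + e * m + e\<^sup>2 * p e) * (Z - e * m + e\<^sup>2 * q e)
          \<le> (\<integral>x. exp (e * g x - e\<^sup>2 * c e * G x) \<partial>M) * (\<integral>x. exp (- (e * g x)) \<partial>M)"
        using e I J by (intro order_trans[OF mult_left_mono[OF J]] mult_right_mono[OF I]) auto
      also have "\<dots> \<le> Z\<^sup>2" using ineq[of e] e by (simp add: c_def Z_def)
      finally have "e\<^sup>2 * (- m\<^sup>2 + Z * (p e + q e) + e * m * (q e - p e) + e\<^sup>2 * (p e * q e)) \<le> 0"
        by (simp add: power2_eq_square algebra_simps)
      then show "- m\<^sup>2 + Z * (p e + q e) + e * m * (q e - p e) + e\<^sup>2 * (p e * q e) \<le> 0"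
        using e by (simp add: mult_le_0_iff)
    qed
    moreover have "((\<lambda>e. - m\<^sup>2 + Z * (p e + q e) + e * m * (q e - p e) + e\<^sup>2 * (p e * q e))
        \<longlongrightarrow> - m\<^sup>2 + Z * (s / 2 - 1 / l * G1 + s / 2)) (at_right 0)"
      by (auto intro!: tendsto_eq_intros plim qlim)
    ultimately have "- m\<^sup>2 + Z * (s / 2 - 1 / l * G1 + s / 2) \<le> 0"
      by (intro tendsto_upperbound) auto
    then show ?thesis
      unfolding Z_def[symmetric] m_def[symmetric] s_def[symmetric] G1_def[symmetric]
      by (simp add: algebra_simps)
  qed
qed

text \<open>Prekopa--Leindler for the weights
  \<open>exp (\<epsilon> g - \<epsilon>\<^sup>2 |\<nabla>g|\<^sup>2 / (l - 2 \<epsilon> K) - f)\<close>, \<open>exp (- \<epsilon> g - f)\<close> and \<open>exp (- f)\<close> on \<open>U\<close>;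
  the role of the gradient of \<open>g\<close>, transformed by \<open>T\<close>, is played by \<open>h\<close>.\<close>

theorem poincare_strongly_convex:
  fixes f g :: "'a::euclidean_space \<Rightarrow> real" and T h :: "'a \<Rightarrow> 'b::euclidean_space"
  assumes U [measurable]: "U \<in> sets borel" and "convex U"
    and meas [measurable]: "f \<in> borel_measurable borel" "g \<in> borel_measurable borel" "h \<in> borel_measurable borel"
    and int: "integrable lborel (\<lambda>x. indicator U x * exp (- f x))"
    and l: "0 < l"
    and f: "\<And>x y. x \<in> U \<Longrightarrow> y \<in> U \<Longrightarrow>
      2 * f ((1 / 2) *\<^sub>R (x + y)) + l / 4 * (norm (T (y - x)))\<^sup>2 \<le> f x + f y"
    and g: "\<And>x y. x \<in> U \<Longrightarrow> y \<in> U \<Longrightarrow>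
      g x + h x \<bullet> T (y - x) - K / 2 * (norm (T (y - x)))\<^sup>2 \<le> g y"
    and bd: "\<And>x. x \<in> U \<Longrightarrow> \<bar>g x\<bar> \<le> B" "\<And>x. x \<in> U \<Longrightarrow> (norm (h x))\<^sup>2 \<le> B"
  defines "M \<equiv> density lborel (\<lambda>x. ennreal (indicator U x * exp (- f x)))"
  shows "measure M UNIV * (\<integral>x. (g x)\<^sup>2 \<partial>M) - (\<integral>x. g x \<partial>M)\<^sup>2
      \<le> measure M UNIV / l * (\<integral>x. (norm (h x))\<^sup>2 \<partial>M)"
proof -
  have M: "finite_measure M"
  proof
    have "(\<integral>\<^sup>+x. ennreal (indicator U x * exp (- f x)) \<partial>lborel) < \<infinity>"
      using int by (subst nn_integral_eq_integral) auto
    then show "emeasure M (space M) \<noteq> \<infinity>"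
      by (simp add: M_def emeasure_density less_top[symmetric])
  qed
  interpret finite_measure M by fact
  have [measurable_cong, simp]: "sets M = sets borel" and [simp]: "space M = UNIV"
    by (auto simp: M_def)
  have AE_M: "AE x in M. P x" if "\<And>x. x \<in> U \<Longrightarrow> P x" for P
    using that unfolding M_def
    by (subst AE_density) (auto intro!: AE_I2 simp: indicator_def ennreal_mult_less_top)
  have nn: "(\<integral>\<^sup>+x. ennreal (indicator U x * exp (k x - f x)) \<partial>lborel) = ennreal (\<integral>x. exp (k x) \<partial>M)"
    if [measurable]: "k \<in> borel_measurable borel" and k: "\<And>x. x \<in> U \<Longrightarrow> k x \<le> C" for k C
  proof -
    have "integrable M (\<lambda>x. exp (k x))"
    proof (rule integrable_bounded_AE[OF M])
      show "AE x in M. \<bar>exp (k x)\<bar> \<le> exp C" using k by (intro AE_M) auto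
    qed measurable
    then have "ennreal (\<integral>x. exp (k x) \<partial>M) = (\<integral>\<^sup>+x. ennreal (exp (k x)) \<partial>M)"
      by (subst nn_integral_eq_integral) auto
    also have "\<dots> = (\<integral>\<^sup>+x. ennreal (indicator U x * exp (- f x)) * ennreal (exp (k x)) \<partial>lborel)"
      unfolding M_def by (subst nn_integral_density) auto
    also have "\<dots> = (\<integral>\<^sup>+x. ennreal (indicator U x * exp (k x - f x)) \<partial>lborel)"
      by (intro nn_integral_cong) (auto simp: indicator_def exp_diff exp_minus field_simps simp flip: ennreal_mult)
    finally show ?thesis by simp
  qed
  have "measure M (space M) * (\<integral>x. (g x)\<^sup>2 \<partial>M) - (\<integral>x. g x \<partial>M)\<^sup>2
      \<le> measure M (space M) / l * (\<integral>x. (norm (h x))\<^sup>2 \<partial>M)"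
  proof (rule variance_le_of_exp_inequality[OF M _ _ _ _ l])
    show "AE x in M. \<bar>g x\<bar> \<le> B" "AE x in M. 0 \<le> (norm (h x))\<^sup>2 \<and> (norm (h x))\<^sup>2 \<le> B"
      using bd by (auto intro!: AE_M)
    fix e assume e: "0 < e" "2 * e * K < l"
    define k where "k = l - 2 * e * K"
    have k: "0 < k" using e by (simp add: k_def)
    define u where "u x = e * g x - e\<^sup>2 * (1 / k) * (norm (h x))\<^sup>2" for x
    have [measurable]: "u \<in> borel_measurable borel" unfolding u_def by measurable
    have key: "u x - f x + (- (e * g y) - f y) \<le> - (2 * f ((1 / 2) *\<^sub>R (x + y)))"
      if xy: "x \<in> U" "y \<in> U" for x y
    proof -
      define d where "d = norm (T (y - x))"
      define a where "a = norm (h x)"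
      have "- (a * d) \<le> h x \<bullet> T (y - x)"
        using Cauchy_Schwarz_ineq2[of "h x" "T (y - x)"] by (auto simp: a_def d_def)
      then have "g x - a * d - K / 2 * d\<^sup>2 \<le> g y"
        using g[OF xy] by (simp add: d_def)
      then have 1: "e * (g x - a * d - K / 2 * d\<^sup>2) \<le> e * g y"
        using e by (intro mult_left_mono) auto
      \<comment> \<open>Completing the square. Of the convexity gain
        \<open>l / 4 * d\<^sup>2\<close>, the part \<open>e * K / 2 * d\<^sup>2\<close> pays for the
        quadratic error of \<open>g\<close>; the rest is \<open>k / 4 * d\<^sup>2\<close> and
        dominates the linear term up to \<open>e\<^sup>2 * a\<^sup>2 / k\<close>. This is the origin
        of \<open>k\<close>, and \<open>K\<close> disappears from the limit.\<close>
      have "0 \<le> (k * d / 2 - e * a)\<^sup>2 / k" using k by simp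
      also have "\<dots> = k / 4 * d\<^sup>2 - e * a * d + e\<^sup>2 * (1 / k) * a\<^sup>2"
        using k by (simp add: power2_eq_square field_simps)
      finally have "e * a * d - e\<^sup>2 * (1 / k) * a\<^sup>2 + e * K / 2 * d\<^sup>2 \<le> l / 4 * d\<^sup>2"
        unfolding k_def by (simp only: left_diff_distrib diff_divide_distrib)
      then show ?thesis
        using 1 f[OF xy] unfolding u_def a_def[symmetric] d_def[symmetric]
        by (simp add: algebra_simps)
    qed
    have "(\<integral>\<^sup>+x. ennreal (indicator U x * exp (u x - f x)) \<partial>lborel)
        * (\<integral>\<^sup>+x. ennreal (indicator U x * exp (- (e * g x) - f x)) \<partial>lborel)
        \<le> (\<integral>\<^sup>+x. ennreal (indicator U x * exp (0 - f x)) \<partial>lborel)\<^sup>2"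
    proof (rule prekopa_leindler)
      fix x y
      show "ennreal (indicator U x * exp (u x - f x)) * ennreal (indicator U y * exp (- (e * g y) - f y))
          \<le> (ennreal (indicator U ((1 / 2) *\<^sub>R (x + y)) * exp (0 - f ((1 / 2) *\<^sub>R (x + y)))))\<^sup>2"
      proof (cases "x \<in> U \<and> y \<in> U")
        case True
        then have "(1 / 2) *\<^sub>R (x + y) \<in> U"
          using convexD[OF \<open>convex U\<close>, of x y "1/2" "1/2"] by (simp add: scaleR_add_right)
        moreover have "exp (u x - f x) * exp (- (e * g y) - f y) \<le> (exp (- f ((1 / 2) *\<^sub>R (x + y))))\<^sup>2"
          using key[of x y] True by (simp flip: exp_add exp_double)
        ultimately show ?thesis
          using True by (auto simp: ennreal_power simp flip: ennreal_mult intro!: ennreal_leI)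
      qed (auto simp: indicator_def)
    qed measurable
    moreover have "(\<integral>\<^sup>+x. ennreal (indicator U x * exp (u x - f x)) \<partial>lborel) = ennreal (\<integral>x. exp (u x) \<partial>M)"
    proof (rule nn)
      fix x assume "x \<in> U"
      then have "e * g x \<le> e * B" using bd(1)[of x] e by (intro mult_left_mono) auto
      moreover have "0 \<le> e\<^sup>2 * (1 / k) * (norm (h x))\<^sup>2" using k by simp
      ultimately show "u x \<le> e * B" unfolding u_def by linarith
    qed measurable
    moreover have "(\<integral>\<^sup>+x. ennreal (indicator U x * exp (- (e * g x) - f x)) \<partial>lborel)
        = ennreal (\<integral>x. exp (- (e * g x)) \<partial>M)"
    proof (rule nn)
      fix x assume "x \<in> U"
      then have "e * (- g x) \<le> e * B" using bd(1)[of x] e by (intro mult_left_mono) auto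
      then show "- (e * g x) \<le> e * B" by simp
    qed measurable
    moreover have "(\<integral>\<^sup>+x. ennreal (indicator U x * exp (0 - f x)) \<partial>lborel) = ennreal (measure M UNIV)"
      using nn[of "\<lambda>_. 0" 0] by simp
    ultimately have "ennreal (\<integral>x. exp (u x) \<partial>M) * ennreal (\<integral>x. exp (- (e * g x)) \<partial>M)
        \<le> (ennreal (measure M UNIV))\<^sup>2"
      by simp
    then show "(\<integral>x. exp (e * g x - e\<^sup>2 * (1 / (l - 2 * e * K)) * (norm (h x))\<^sup>2) \<partial>M) * (\<integral>x. exp (- (e * g x)) \<partial>M)
        \<le> (measure M (space M))\<^sup>2"
      by (simp add: u_def k_def ennreal_power ennreal_le_iff flip: ennreal_mult)
  qed measurable
  then show ?thesis by simp
qed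

subsection \<open>Matrices and linear changes of variables\<close>

lemma matrix_inv_mult:
  fixes A :: "real ^ 'n ^ 'n"
  assumes "invertible A"
  shows "A ** matrix_inv A = mat 1" "matrix_inv A ** A = mat 1"
  using assms someI_ex[of "\<lambda>A'. A ** A' = mat 1 \<and> A' ** A = mat 1"]
  unfolding invertible_def matrix_inv_def by auto

lemma matrix_inv_unique:
  fixes A B :: "real ^ 'n ^ 'n"
  assumes "A ** B = mat 1"
  shows "matrix_inv A = B"
proof -
  have "invertible A"
    using assms matrix_left_right_inverse[of A B] by (auto simp: invertible_def)
  then have "B = (matrix_inv A ** A) ** B" by (simp add: matrix_inv_mult)
  also have "\<dots> = matrix_inv A" by (simp add: matrix_mul_assoc[symmetric] assms)
  finally show ?thesis by simp
qed

lemma sym_pos_def_invertible: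
  assumes "sym_pos_def A"
  shows "invertible A"
proof -
  have "A *v x = 0 \<longrightarrow> x = 0" for x
    using assms by (metis inner_zero_right less_irrefl sym_pos_def_def)
  then show ?thesis
    by (simp add: invertible_left_inverse matrix_left_invertible_ker)
qed

lemma opnorm_mult_vec: "norm (A *v x) \<le> opnorm A * norm x"
  unfolding opnorm_def by (rule onorm) (rule matrix_vector_mul_bounded_linear)

lemma opnorm_nonneg: "0 \<le> opnorm A"
  unfolding opnorm_def by (rule onorm_pos_le) (rule matrix_vector_mul_bounded_linear)

lemma opnorm_leI:
  assumes "\<And>x. norm (A *v x) \<le> b * norm x"
  shows "opnorm A \<le> b"
  unfolding opnorm_def by (rule onorm_le) (rule assms)

text \<open>For \<open>y = transpose A *v x\<close>, moving the matrix across the inner product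
  gives \<open>norm y ^ 2 \<le> norm x * (opnorm A * norm y)\<close>, and one factor
  \<open>norm y\<close> cancels.\<close>

lemma opnorm_transpose_le: "opnorm (transpose A) \<le> opnorm A"
proof (rule opnorm_leI)
  fix x
  define y where "y = transpose A *v x"
  have "(norm y)\<^sup>2 = x \<bullet> (A *v y)"
    unfolding power2_norm_eq_inner by (subst y_def) (simp add: dot_lmul_matrix)
  also have "\<dots> \<le> norm x * (opnorm A * norm y)"
    by (intro order_trans[OF norm_cauchy_schwarz] mult_left_mono opnorm_mult_vec) auto
  finally have "norm y * norm y \<le> (opnorm A * norm x) * norm y"
    by (simp add: power2_eq_square mult_ac)
  then show "norm (transpose A *v x) \<le> opnorm A * norm x"
    unfolding y_def[symmetric]
    using opnorm_nonneg[of A] by (cases "norm y = 0") (auto simp: mult_le_cancel_right)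
qed

lemma opnorm_transpose: "opnorm (transpose A) = opnorm A"
  using opnorm_transpose_le[of A] opnorm_transpose_le[of "transpose A"] by simp

section \<open>Lebesgue measure under invertible linear maps\<close>

lemma borel_measurable_matrix_vector_mult [measurable (raw)]:
  fixes A :: "real ^ 'n ^ 'm"
  assumes "f \<in> borel_measurable M"
  shows "(\<lambda>x. A *v f x) \<in> borel_measurable M"
  using assms linear_continuous_on[OF matrix_vector_mul_bounded_linear, of UNIV A]
  by (intro measurable_compose[OF assms] borel_measurable_continuous_onI)

text \<open>Lebesgue measure is determined by its values on boxes; the preimage of a box is the box
  with permuted bounds, whose side lengths have the same product.\<close>

lemma lborel_permute_transposition:
  "distr lborel borel (\<lambda>x::real^'n. \<chi> i. x $ Transposition.transpose m n i) = lborel" (is "distr _ _ ?T = _")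
proof (rule lborel_eqI[symmetric])
  fix l u :: "real ^ 'n"
  assume le: "\<And>b. b \<in> Basis \<Longrightarrow> l \<bullet> b \<le> u \<bullet> b"
  let ?p = "Transposition.transpose m n"
  have le': "l $ i \<le> u $ i" for i
    using le[of "axis i 1"] by (simp add: inner_axis)
  have [measurable]: "?T \<in> borel_measurable borel"
    by (intro borel_measurable_continuous_onI continuous_intros)
  have "?T -` box l u = box (?T l) (?T u)"
    by (auto simp: mem_box_cart) (metis transpose_involutory)+
  then have "emeasure (distr lborel borel ?T) (box l u) = emeasure lborel (box (?T l) (?T u))"
    by (simp add: emeasure_distr)
  also have "\<dots> = ennreal (\<Prod>b\<in>Basis. (?T u - ?T l) \<bullet> b)"
    using le' by (subst emeasure_lborel_box_eq) (auto simp: Basis_vec_def inner_axis)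
  also have "(\<Prod>b\<in>Basis. (?T u - ?T l) \<bullet> b) = (\<Prod>i\<in>UNIV. u $ ?p i - l $ ?p i)"
    by (simp add: Basis_vec_def UNION_singleton_eq_range inner_axis)
       (subst prod.reindex; auto simp: inj_on_def axis_eq_axis inner_axis)
  also have "\<dots> = (\<Prod>i\<in>UNIV. u $ i - l $ i)"
    by (rule prod.reindex_bij_betw) simp
  also have "\<dots> = (\<Prod>b\<in>Basis. (u - l) \<bullet> b)"
    by (simp add: Basis_vec_def UNION_singleton_eq_range inner_axis)
       (subst prod.reindex; auto simp: inj_on_def axis_eq_axis inner_axis)
  finally show "emeasure (distr lborel borel ?T) (box l u) = ennreal (\<Prod>b\<in>Basis. (u - l) \<bullet> b)" .
qed simp

text \<open>Fubini with coordinate \<open>m\<close> innermost: on each line in that direction the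
  shear is a translation by \<open>x $ n\<close>, which is constant there because
  \<open>m \<noteq> n\<close>.\<close>

lemma nn_integral_shear:
  fixes F :: "real ^ 'n \<Rightarrow> ennreal"
  assumes F [measurable]: "F \<in> borel_measurable borel" and mn: "m \<noteq> n"
  shows "(\<integral>\<^sup>+x. F (x + (x $ n) *\<^sub>R axis m 1) \<partial>lborel) = (\<integral>\<^sup>+x. F x \<partial>lborel)"
proof -
  interpret product_sigma_finite "\<lambda>_::real^'n. lborel :: real measure" by standard
  let ?b = "axis m 1 :: real ^ 'n" and ?c = "axis n 1 :: real ^ 'n"
  define I where "I = (Basis :: (real ^ 'n) set) - {?b}"
  let ?T = "\<lambda>f. \<Sum>b\<in>(Basis :: (real ^ 'n) set). f b *\<^sub>R b"
  have I: "finite I" "?b \<notin> I" "insert ?b I = Basis" "?c \<in> I"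
    using mn by (auto simp: I_def axis_eq_axis)
  have split: "(\<integral>\<^sup>+x. h x \<partial>lborel) = (\<integral>\<^sup>+f. (\<integral>\<^sup>+t. h (t *\<^sub>R ?b + (\<Sum>b\<in>I. f b *\<^sub>R b)) \<partial>lborel) \<partial>(\<Pi>\<^sub>M b\<in>I. lborel))"
    if [measurable]: "h \<in> borel_measurable borel" for h :: "real ^ 'n \<Rightarrow> ennreal"
  proof -
    have "(\<integral>\<^sup>+x. h x \<partial>lborel) = (\<integral>\<^sup>+f. h (?T f) \<partial>(\<Pi>\<^sub>M b\<in>Basis. lborel))"
      by (subst lborel_eq) (simp add: nn_integral_distr)
    also have "\<dots> = (\<integral>\<^sup>+f. (\<integral>\<^sup>+t. h (?T (f(?b := t))) \<partial>lborel) \<partial>(\<Pi>\<^sub>M b\<in>I. lborel))"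
      using I(1,2) unfolding I(3)[symmetric] by (subst product_nn_integral_insert) auto
    also have "(\<lambda>f t. ?T (f(?b := t))) = (\<lambda>f t. t *\<^sub>R ?b + (\<Sum>b\<in>I. f b *\<^sub>R b))"
      using I(1,2) unfolding I(3)[symmetric] by (auto intro!: sum.cong ext)
    finally show ?thesis .
  qed
  have "(\<integral>\<^sup>+t. F ((t *\<^sub>R ?b + (\<Sum>b\<in>I. f b *\<^sub>R b)) + ((t *\<^sub>R ?b + (\<Sum>b\<in>I. f b *\<^sub>R b)) $ n) *\<^sub>R ?b) \<partial>lborel)
      = (\<integral>\<^sup>+t. F (t *\<^sub>R ?b + (\<Sum>b\<in>I. f b *\<^sub>R b)) \<partial>lborel)" for f
  proof -
    have "(t *\<^sub>R ?b + (\<Sum>b\<in>I. f b *\<^sub>R b)) $ n = f ?c" for t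
    proof -
      have "(\<Sum>b\<in>I. f b *\<^sub>R b) \<bullet> ?c = (\<Sum>b\<in>I. if b = ?c then f b else 0)"
        unfolding inner_sum_left by (rule sum.cong) (use I in \<open>auto simp: I_def inner_Basis\<close>)
      then have "(\<Sum>b\<in>I. f b *\<^sub>R b) $ n = f ?c"
        using I by (simp only: inner_axis inner_real_def mult_1_right) simp
      then show ?thesis
        using mn unfolding vector_add_component by (simp add: axis_def del: sum_component)
    qed
    then show ?thesis
      by (subst (2) nn_integral_real_affine[of _ 1 "f ?c"]) (auto simp: algebra_simps)
  qed
  then show ?thesis by (simp add: split)
qed

text \<open>The library's linear change of variables requires a well-ordered index type.\<close>

lemma nn_integral_linear_image:
  fixes A :: "real ^ 'n ^ 'n" and F :: "real ^ 'n \<Rightarrow> ennreal"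
  assumes "invertible A" "F \<in> borel_measurable borel"
  shows "ennreal \<bar>det A\<bar> * (\<integral>\<^sup>+x. F (A *v x) \<partial>lborel) = (\<integral>\<^sup>+x. F x \<partial>lborel)"
proof -
  \<comment> \<open>Induction over products of elementary matrices. The determinant condition is
    part of the claim, so that the generators with a zero row become vacuous; \<open>F\<close> is
    quantified inside, since for a product \<open>A ** B\<close> the claim for \<open>B\<close> is
    applied to \<open>F\<close> composed with \<open>A\<close>.\<close>
  have "det A \<noteq> 0 \<longrightarrow> (\<forall>F \<in> borel_measurable borel.
      ennreal \<bar>det A\<bar> * (\<integral>\<^sup>+x. F (A *v x) \<partial>lborel) = (\<integral>\<^sup>+x. F x \<partial>lborel))"
  proof (induction A rule: induct_matrix_elementary_alt)
    case (1 A B)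
    show ?case
    proof (intro impI ballI)
      fix F :: "real ^ 'n \<Rightarrow> ennreal" assume [measurable]: "F \<in> borel_measurable borel"
      assume "det (A ** B) \<noteq> 0"
      then have nz: "det A \<noteq> 0" "det B \<noteq> 0" by (auto simp: det_mul)
      have FA: "(\<lambda>x. F (A *v x)) \<in> borel_measurable borel" by measurable
      have "ennreal \<bar>det (A ** B)\<bar> * (\<integral>\<^sup>+x. F ((A ** B) *v x) \<partial>lborel)
          = ennreal \<bar>det A\<bar> * (ennreal \<bar>det B\<bar> * (\<integral>\<^sup>+x. F (A *v (B *v x)) \<partial>lborel))"
        by (simp add: det_mul abs_mult ennreal_mult mult.assoc matrix_vector_mul_assoc)
      also have "\<dots> = (\<integral>\<^sup>+x. F x \<partial>lborel)"
        using 1(1)[THEN mp, OF nz(1), THEN bspec, OF \<open>F \<in> _\<close>] 1(2)[THEN mp, OF nz(2), THEN bspec, OF FA]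
        by simp
      finally show "ennreal \<bar>det (A ** B)\<bar> * (\<integral>\<^sup>+x. F ((A ** B) *v x) \<partial>lborel) = (\<integral>\<^sup>+x. F x \<partial>lborel)" .
    qed
  next
    case (2 A i)
    then show ?case by (simp add: det_zero_row)
  next
    case (3 A)
    then have det: "det A = (\<Prod>i\<in>UNIV. A $ i $ i)" by (rule det_diagonal)
    show ?case
    proof (intro impI ballI)
      fix F :: "real ^ 'n \<Rightarrow> ennreal" assume [measurable]: "F \<in> borel_measurable borel"
      assume nz: "det A \<noteq> 0"
      define c where "c b = b \<bullet> (A *v b)" for b
      have c: "c (axis i 1) = A $ i $ i" for i
        by (simp add: c_def matrix_vector_mult_basis inner_axis' column_def)
      have Ax: "0 + (\<Sum>j\<in>Basis. (c j * (x \<bullet> j)) *\<^sub>R j) = A *v x" for x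
      proof -
        have "(A *v x) $ i = A $ i $ i * x $ i" for i
          unfolding matrix_vector_mult_def
          by (simp, subst sum.remove[of _ i]) (auto simp: 3 intro!: sum.neutral)
        moreover have "(\<Sum>j\<in>Basis. (c j * (x \<bullet> j)) *\<^sub>R j) = (\<Sum>i\<in>UNIV. (A $ i $ i * x $ i) *\<^sub>R axis i 1)"
          by (simp add: Basis_vec_def UNION_singleton_eq_range)
             (subst sum.reindex; auto simp: inj_on_def axis_eq_axis inner_axis c)
        ultimately show ?thesis
          by (simp add: vec_eq_iff axis_def if_distrib cong: if_cong)
      qed
      have prod: "(\<Prod>j\<in>Basis. \<bar>c j\<bar>) = \<bar>det A\<bar>"
        by (simp add: Basis_vec_def UNION_singleton_eq_range det abs_prod)
           (subst prod.reindex; auto simp: inj_on_def axis_eq_axis c)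
      have "c j \<noteq> 0" if "j \<in> Basis" for j
        using that nz det by (auto simp: Basis_vec_def c)
      from lborel_affine_euclidean[of c 0, OF this]
      have lb: "lborel = density (distr lborel borel ((*v) A)) (\<lambda>_. ennreal \<bar>det A\<bar>)"
        unfolding Ax prod by simp
      show "ennreal \<bar>det A\<bar> * (\<integral>\<^sup>+x. F (A *v x) \<partial>lborel) = (\<integral>\<^sup>+x. F x \<partial>lborel)"
        by (subst (2) lb) (simp add: nn_integral_density nn_integral_distr nn_integral_cmult)
    qed
  next
    case (4 m n)
    let ?A = "\<chi> i j. mat 1 $ i $ Transposition.transpose m n j :: real ^ 'n ^ 'n"
    let ?T = "\<lambda>x::real^'n. \<chi> i. x $ Transposition.transpose m n i"
    have "det ?A = of_int (sign (Transposition.transpose m n)) * det (mat 1 :: real ^ 'n ^ 'n)"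
      by (intro det_permute_columns permutes_swap_id) auto
    then have det: "\<bar>det ?A\<bar> = 1" using 4 by (simp add: sign_swap_id)
    have A: "?A *v x = ?T x" for x
    proof -
      have "(\<Sum>j\<in>UNIV. (if i = Transposition.transpose m n j then 1 else 0) * x $ j)
          = (\<Sum>j\<in>UNIV. if j = Transposition.transpose m n i then x $ j else 0)" for i
        by (rule sum.cong) (auto simp: transpose_eq_iff)
      then show ?thesis
        by (simp add: matrix_vector_mult_def mat_def vec_eq_iff)
    qed
    show ?case
    proof (intro impI ballI)
      fix F :: "real ^ 'n \<Rightarrow> ennreal" assume [measurable]: "F \<in> borel_measurable borel"
      have [measurable]: "?T \<in> borel_measurable borel"
        by (intro borel_measurable_continuous_onI continuous_intros)
      have "(\<integral>\<^sup>+x. F (?T x) \<partial>lborel) = (\<integral>\<^sup>+x. F x \<partial>distr lborel borel ?T)"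
        by (subst nn_integral_distr) auto
      then show "ennreal \<bar>det ?A\<bar> * (\<integral>\<^sup>+x. F (?A *v x) \<partial>lborel) = (\<integral>\<^sup>+x. F x \<partial>lborel)"
        by (simp only: A det lborel_permute_transposition) simp
    qed
  next
    case (5 m n)
    let ?A = "\<chi> i j. of_bool (i = m \<and> j = n \<or> i = j) :: real ^ 'n ^ 'n"
    have "?A = (\<chi> k. if k = m then row m (mat 1) + 1 *s row n (mat 1) else row k (mat 1))"
      using 5 by (auto simp: vec_eq_iff row_def mat_def)
    then have det: "det ?A = 1"
      using 5 det_row_operation[of m n "mat 1 :: real ^ 'n ^ 'n" 1] by simp
    have A: "?A *v x = x + (x $ n) *\<^sub>R axis m 1" for x
    proof -
      have "(\<Sum>j\<in>UNIV. of_bool (i = m \<and> j = n \<or> i = j) * x $ j)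
          = (\<Sum>j\<in>UNIV. (if j = i then x $ j else 0) + (if j = n then (if i = m then x $ j else 0) else 0))" for i
        using 5 by (intro sum.cong) auto
      then show ?thesis
        by (simp add: matrix_vector_mult_def vec_eq_iff sum.distrib axis_def)
    qed
    show ?case
      unfolding det A using 5 by (simp add: nn_integral_shear)
  qed
  then show ?thesis using assms by (simp add: invertible_det_nz)
qed

subsection \<open>Gaussian moments\<close>

lemma nn_integral_even_moment:
  "(\<integral>\<^sup>+x. ennreal (x ^ (2 * k) * exp (- x\<^sup>2 / 2)) \<partial>lborel)
     = ennreal (sqrt (2 * pi) * (fact (2 * k) / (2 ^ k * fact k)))"
proof -
  have "has_bochner_integral lborel (\<lambda>x. sqrt (2 * pi) * (std_normal_density x * x ^ (2 * k)))
      (sqrt (2 * pi) * (fact (2 * k) / (2 ^ k * fact k)))"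
    by (intro has_bochner_integral_mult_right std_normal_moment_even)
  moreover have "sqrt (2 * pi) * (std_normal_density x * x ^ (2 * k)) = x ^ (2 * k) * exp (- x\<^sup>2 / 2)" for x
    by (simp add: std_normal_density_def)
  ultimately have "has_bochner_integral lborel (\<lambda>x::real. x ^ (2 * k) * exp (- x\<^sup>2 / 2))
      (sqrt (2 * pi) * (fact (2 * k) / (2 ^ k * fact k)))" by simp
  then show ?thesis
    by (auto simp: has_bochner_integral_iff nn_integral_eq_integral power_mult)
qed

text \<open>The Gaussian weight is a product over coordinates, and only the factor at
  \<open>c\<close> carries a power. The case \<open>k = 0\<close> is the total mass,
  \<open>k = 2\<close> the fourth moment.\<close>

lemma nn_integral_gaussian_coordinate:
  fixes c :: "'a::euclidean_space"
  assumes c: "c \<in> Basis"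
  shows "(\<integral>\<^sup>+x. ennreal ((x \<bullet> c) ^ (2 * k) * exp (- (norm x)\<^sup>2 / 2)) \<partial>lborel)
       = ennreal (fact (2 * k) / (2 ^ k * fact k) * sqrt (2 * pi) ^ DIM('a))"
proof -
  define h where "h b t = ennreal ((if b = c then t ^ (2 * k) else 1) * exp (- t\<^sup>2 / 2))" for b :: 'a and t
  have [measurable]: "h b \<in> borel_measurable borel" for b
    unfolding h_def by measurable
  have "(x \<bullet> c) ^ (2 * k) * exp (- (norm x)\<^sup>2 / 2)
      = (\<Prod>b\<in>Basis. (if b = c then (x \<bullet> b) ^ (2 * k) else 1) * exp (- (x \<bullet> b)\<^sup>2 / 2))" for x :: 'a
  proof -
    have "(norm x)\<^sup>2 = (\<Sum>b\<in>Basis. (x \<bullet> b)\<^sup>2)"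
      unfolding power2_norm_eq_inner by (subst euclidean_inner) (simp add: power2_eq_square)
    then have "exp (- (norm x)\<^sup>2 / 2) = (\<Prod>b\<in>Basis. exp (- (x \<bullet> b)\<^sup>2 / 2))"
      by (simp add: sum_divide_distrib flip: exp_sum sum_negf)
    then show ?thesis
      using c by (simp add: prod.distrib)
  qed
  then have "(\<integral>\<^sup>+x. ennreal ((x \<bullet> c) ^ (2 * k) * exp (- (norm x)\<^sup>2 / 2)) \<partial>lborel)
      = (\<integral>\<^sup>+x. (\<Prod>b\<in>Basis. h b (x \<bullet> b)) \<partial>lborel)"
    unfolding h_def by (subst prod_ennreal) (auto simp: power_mult)
  also have "\<dots> = (\<Prod>b\<in>Basis. (\<integral>\<^sup>+t. h b t \<partial>lborel))"
    by (rule nn_integral_lborel_prod) auto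
  also have "\<dots> = (\<Prod>b\<in>(Basis :: 'a set). ennreal (if b = c then sqrt (2 * pi) * (fact (2 * k) / (2 ^ k * fact k)) else sqrt (2 * pi)))"
  proof (rule prod.cong)
    fix b :: 'a
    show "(\<integral>\<^sup>+t. h b t \<partial>lborel)
        = ennreal (if b = c then sqrt (2 * pi) * (fact (2 * k) / (2 ^ k * fact k)) else sqrt (2 * pi))"
      using nn_integral_even_moment[of k] nn_integral_even_moment[of 0] by (simp add: h_def)
  qed simp
  also have "\<dots> = ennreal (\<Prod>b\<in>(Basis :: 'a set). (if b = c then fact (2 * k) / (2 ^ k * fact k) else 1) * sqrt (2 * pi))"
    by (subst prod_ennreal) (auto intro!: arg_cong[where f = ennreal] prod.cong)
  also have "\<dots> = ennreal (fact (2 * k) / (2 ^ k * fact k) * sqrt (2 * pi) ^ DIM('a))"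
    using c by (simp add: prod.distrib)
  finally show ?thesis .
qed

text \<open>By rotation invariance \<open>c\<close> may be turned into a multiple of a coordinate
  vector. The 3 is 4! / (2^2 * 2!).\<close>

lemma gaussian_fourth_moment:
  fixes c :: "real ^ 'n"
  shows "has_bochner_integral lborel (\<lambda>x. (c \<bullet> x) ^ 4 * exp (- (norm x)\<^sup>2 / 2))
           (3 * norm c ^ 4 * sqrt (2 * pi) ^ CARD('n))"
proof (rule has_bochner_integral_nn_integral)
  define k :: 'n where "k = undefined"
  define b where "b = (axis k 1 :: real ^ 'n)"
  have b: "b \<in> Basis" "norm b = 1" by (simp_all add: b_def)
  obtain R where R: "orthogonal_transformation R" "R c = norm c *\<^sub>R b"
    using orthogonal_transformation_exists[of c "norm c *\<^sub>R b"] b by auto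
  have lin: "linear R" using R(1) by (rule orthogonal_transformation_linear)
  define A where "A = matrix R"
  have A: "A *v x = R x" for x using lin by (simp add: A_def)
  have det: "\<bar>det A\<bar> = 1" using R(1) by (simp add: A_def)
  then have inv: "invertible A" by (auto simp: invertible_det_nz)
  have cx: "c \<bullet> x = norm c * ((A *v x) \<bullet> b)" for x
    using R by (simp add: A orthogonal_transformation_def flip: R(2)) (metis R(2) inner_commute inner_scaleR_right orthogonal_transformation_def)
  have "(\<integral>\<^sup>+x. ennreal ((c \<bullet> x) ^ 4 * exp (- (norm x)\<^sup>2 / 2)) \<partial>lborel)
      = (\<integral>\<^sup>+x. ennreal ((norm c * ((A *v x) \<bullet> b)) ^ 4 * exp (- (norm (A *v x))\<^sup>2 / 2)) \<partial>lborel)"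
    using R(1) by (simp add: cx A orthogonal_transformation_norm)
  also have "\<dots> = (\<integral>\<^sup>+x. ennreal ((norm c * (x \<bullet> b)) ^ 4 * exp (- (norm x)\<^sup>2 / 2)) \<partial>lborel)"
    using nn_integral_linear_image[OF inv, of "\<lambda>x. ennreal ((norm c * (x \<bullet> b)) ^ 4 * exp (- (norm x)\<^sup>2 / 2))"] det
    by simp
  also have "\<dots> = (\<integral>\<^sup>+x. ennreal (norm c ^ 4) * ennreal ((x \<bullet> b) ^ (2 * 2) * exp (- (norm x)\<^sup>2 / 2)) \<partial>lborel)"
    by (intro nn_integral_cong) (simp add: power_mult_distrib mult.assoc flip: ennreal_mult')
  also have "\<dots> = ennreal (norm c ^ 4) * ennreal (fact (2 * 2) / (2 ^ 2 * fact 2) * sqrt (2 * pi) ^ CARD('n))"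
    using nn_integral_gaussian_coordinate[OF b(1), of 2] by (subst nn_integral_cmult) auto
  also have "\<dots> = ennreal (3 * norm c ^ 4 * sqrt (2 * pi) ^ CARD('n))"
    by (simp add: fact_numeral flip: ennreal_mult)
  finally show "(\<integral>\<^sup>+x. ennreal ((c \<bullet> x) ^ 4 * exp (- (norm x)\<^sup>2 / 2)) \<partial>lborel)
      = ennreal (3 * norm c ^ 4 * sqrt (2 * pi) ^ CARD('n))" .
qed (auto intro!: AE_I2 mult_nonneg_nonneg)

lemma gaussian_total_mass:
  "has_bochner_integral lborel (\<lambda>x::real^'n. exp (- (norm x)\<^sup>2 / 2)) (sqrt (2 * pi) ^ CARD('n))"
proof (rule has_bochner_integral_nn_integral)
  show "(\<integral>\<^sup>+x. ennreal (exp (- (norm x)\<^sup>2 / 2)) \<partial>(lborel :: (real ^ 'n) measure)) = ennreal (sqrt (2 * pi) ^ CARD('n))"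
    using nn_integral_gaussian_coordinate[of "axis undefined 1 :: real ^ 'n" 0] by simp
qed auto

text \<open>Polarization: \<open>12 a\<^sup>2 b\<^sup>2 = (a + b)\<^sup>4 + (a - b)\<^sup>4 - 2 a\<^sup>4 - 2 b\<^sup>4\<close>.\<close>

lemma gaussian_mixed_fourth_moment:
  fixes a b :: "real ^ 'n"
  shows "has_bochner_integral lborel (\<lambda>x. ((a \<bullet> x)\<^sup>2 * (b \<bullet> x)\<^sup>2) * exp (- (norm x)\<^sup>2 / 2))
           (((norm a)\<^sup>2 * (norm b)\<^sup>2 + 2 * (a \<bullet> b)\<^sup>2) * sqrt (2 * pi) ^ CARD('n))"
proof -
  define W where "W = sqrt (2 * pi) ^ CARD('n)"
  let ?e = "\<lambda>x::real^'n. exp (- (norm x)\<^sup>2 / 2)"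
  have "has_bochner_integral lborel
      (\<lambda>x. (1 / 12) * (((a + b) \<bullet> x) ^ 4 * ?e x + ((a - b) \<bullet> x) ^ 4 * ?e x
             - 2 * ((a \<bullet> x) ^ 4 * ?e x) - 2 * ((b \<bullet> x) ^ 4 * ?e x)))
      ((1 / 12) * (3 * norm (a + b) ^ 4 * W + 3 * norm (a - b) ^ 4 * W
             - 2 * (3 * norm a ^ 4 * W) - 2 * (3 * norm b ^ 4 * W)))"
    unfolding W_def
    by (intro has_bochner_integral_mult_right has_bochner_integral_add has_bochner_integral_diff
        gaussian_fourth_moment)
  moreover have "(1 / 12) * (((a + b) \<bullet> x) ^ 4 * ?e x + ((a - b) \<bullet> x) ^ 4 * ?e x
             - 2 * ((a \<bullet> x) ^ 4 * ?e x) - 2 * ((b \<bullet> x) ^ 4 * ?e x)) = ((a \<bullet> x)\<^sup>2 * (b \<bullet> x)\<^sup>2) * ?e x" for x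
    by (simp add: inner_add_left inner_diff_left eval_nat_numeral algebra_simps)
  moreover have "(1 / 12) * (3 * norm (a + b) ^ 4 * W + 3 * norm (a - b) ^ 4 * W
             - 2 * (3 * norm a ^ 4 * W) - 2 * (3 * norm b ^ 4 * W))
      = ((norm a)\<^sup>2 * (norm b)\<^sup>2 + 2 * (a \<bullet> b)\<^sup>2) * W"
  proof -
    have 4: "norm x ^ 4 = (x \<bullet> x)\<^sup>2" for x :: "real ^ 'n"
      by (simp add: power2_norm_eq_inner[symmetric] flip: power_mult)
    show ?thesis
      unfolding 4 power2_norm_eq_inner
      by (simp add: inner_add_left inner_diff_left inner_add_right inner_diff_right inner_commute[of b a]
          power2_eq_square algebra_simps)
  qed
  ultimately show ?thesis by (simp add: W_def)
qed

lemma trace_mult_transpose: "trace (C ** transpose C) = (\<Sum>k\<in>UNIV. (norm (row k C))\<^sup>2)"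
  for C :: "real ^ 'n ^ 'm"
  by (simp add: trace_def matrix_matrix_mult_def transpose_def row_def power2_norm_eq_inner inner_vec_def)

text \<open>The left side is the trace of the square of the Gram matrix C C^T. For fixed
  \<open>k\<close> the inner sum is the squared norm of \<open>C *v row k C\<close>, to which the
  operator norm applies.\<close>

lemma sum_square_inner_rows_le:
  fixes C :: "real ^ 'n ^ 'm"
  shows "(\<Sum>k\<in>UNIV. \<Sum>l\<in>UNIV. (row k C \<bullet> row l C)\<^sup>2) \<le> (opnorm C)\<^sup>2 * trace (C ** transpose C)"
proof -
  have "(\<Sum>l\<in>UNIV. (row k C \<bullet> row l C)\<^sup>2) \<le> (opnorm C)\<^sup>2 * (norm (row k C))\<^sup>2" for k
  proof -
    have "(\<Sum>l\<in>UNIV. (row k C \<bullet> row l C)\<^sup>2) = (norm (C *v row k C))\<^sup>2"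
      unfolding power2_norm_eq_inner inner_vec_def[of "C *v row k C"]
      by (simp add: matrix_vector_mul_component row_def power2_eq_square inner_commute)
    also have "\<dots> \<le> (opnorm C * norm (row k C))\<^sup>2"
      by (intro power_mono opnorm_mult_vec) auto
    finally show ?thesis by (simp add: power_mult_distrib)
  qed
  then show ?thesis
    unfolding trace_mult_transpose sum_distrib_left by (intro sum_mono)
qed

text \<open>Up to the total mass the integral equals t^2 + 2 tr((C C^T)^2) with t = tr(C C^T). The
  second summand is at most twice the squared operator norm times t, and completing the square
  produces the sum of trace and squared operator norm seen in the final bound.\<close>

lemma gaussian_quartic_form:
  fixes C :: "real ^ 'n ^ 'm"
  shows "integrable lborel (\<lambda>x. norm (C *v x) ^ 4 * exp (- (norm x)\<^sup>2 / 2))" (is ?I)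
    and "(\<integral>x. norm (C *v x) ^ 4 * exp (- (norm x)\<^sup>2 / 2) \<partial>lborel)
           \<le> (trace (C ** transpose C) + (opnorm C)\<^sup>2)\<^sup>2 * sqrt (2 * pi) ^ CARD('n)" (is ?L)
proof -
  define W where "W = sqrt (2 * pi) ^ CARD('n)"
  define t where "t = trace (C ** transpose C)"
  define s where "s = (\<Sum>k\<in>UNIV. \<Sum>l\<in>UNIV. (row k C \<bullet> row l C)\<^sup>2)"
  have "norm (C *v x) ^ 4 = (\<Sum>k\<in>UNIV. \<Sum>l\<in>UNIV. (row k C \<bullet> x)\<^sup>2 * (row l C \<bullet> x)\<^sup>2)" for x
  proof -
    have "norm (C *v x) ^ 4 = ((norm (C *v x))\<^sup>2)\<^sup>2" by (simp flip: power_mult)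
    also have "(norm (C *v x))\<^sup>2 = (\<Sum>k\<in>UNIV. (row k C \<bullet> x)\<^sup>2)"
      unfolding power2_norm_eq_inner inner_vec_def[of "C *v x"]
      by (simp add: matrix_vector_mul_component row_def power2_eq_square)
    finally show ?thesis by (simp add: power2_eq_square[of "sum _ _"] sum_product)
  qed
  moreover have "has_bochner_integral lborel
      (\<lambda>x. \<Sum>k\<in>UNIV. \<Sum>l\<in>UNIV. ((row k C \<bullet> x)\<^sup>2 * (row l C \<bullet> x)\<^sup>2) * exp (- (norm x)\<^sup>2 / 2))
      (\<Sum>k\<in>UNIV. \<Sum>l\<in>UNIV. ((norm (row k C))\<^sup>2 * (norm (row l C))\<^sup>2 + 2 * (row k C \<bullet> row l C)\<^sup>2) * W)"
    unfolding W_def by (intro has_bochner_integral_sum gaussian_mixed_fourth_moment)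
  moreover have "(\<Sum>k\<in>UNIV. \<Sum>l\<in>UNIV. ((norm (row k C))\<^sup>2 * (norm (row l C))\<^sup>2 + 2 * (row k C \<bullet> row l C)\<^sup>2) * W)
      = (t\<^sup>2 + 2 * s) * W"
  proof -
    have "(\<Sum>k\<in>UNIV. \<Sum>l\<in>UNIV. (norm (row k C))\<^sup>2 * (norm (row l C))\<^sup>2) = t\<^sup>2"
      by (simp add: t_def trace_mult_transpose power2_eq_square[of "sum _ _"] sum_product)
    moreover have "(\<Sum>k\<in>UNIV. \<Sum>l\<in>UNIV. 2 * (row k C \<bullet> row l C)\<^sup>2) = 2 * s"
      by (simp add: s_def sum_distrib_left)
    ultimately show ?thesis by (simp add: sum.distrib flip: sum_distrib_right)
  qed
  ultimately have *: "has_bochner_integral lborel (\<lambda>x. norm (C *v x) ^ 4 * exp (- (norm x)\<^sup>2 / 2)) ((t\<^sup>2 + 2 * s) * W)"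
    by (simp add: sum_distrib_right)
  then show ?I by (simp add: has_bochner_integral_iff)
  have "t\<^sup>2 + 2 * s \<le> t\<^sup>2 + 2 * ((opnorm C)\<^sup>2 * t)"
    using sum_square_inner_rows_le[of C] by (simp add: s_def t_def)
  also have "\<dots> \<le> (t + (opnorm C)\<^sup>2)\<^sup>2"
    using zero_le_power2[of "(opnorm C)\<^sup>2"] by (simp add: power2_sum)
  finally have "(t\<^sup>2 + 2 * s) * W \<le> (t + (opnorm C)\<^sup>2)\<^sup>2 * W"
    by (intro mult_right_mono) (auto simp: W_def)
  then show ?L using * by (simp add: has_bochner_integral_iff t_def W_def)
qed

section \<open>Gaussians with arbitrary mean and covariance\<close>

lemma has_bochner_integral_affine_image:
  fixes A :: "real ^ 'n ^ 'n" and h :: "real ^ 'n \<Rightarrow> real"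
  assumes A: "invertible A" and h: "has_bochner_integral lborel h v" and nonneg: "\<And>x. 0 \<le> h x"
  shows "has_bochner_integral lborel (\<lambda>x. h (A *v (x - m))) (v / \<bar>det A\<bar>)"
proof (rule has_bochner_integral_nn_integral)
  have [measurable]: "h \<in> borel_measurable borel"
    using borel_measurable_has_bochner_integral[OF h] by simp
  show "(\<lambda>x. h (A *v (x - m))) \<in> borel_measurable lborel" by measurable
  have v: "0 \<le> v" using h nonneg by (auto simp: has_bochner_integral_iff)
  then show "0 \<le> v / \<bar>det A\<bar>" by simp
  show "AE x in lborel. 0 \<le> h (A *v (x - m))" using nonneg by simp
  have det: "0 < \<bar>det A\<bar>" using A by (simp add: invertible_det_nz)
  have "(\<integral>\<^sup>+x. ennreal (h (A *v (x - m))) \<partial>lborel)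
      = (\<integral>\<^sup>+x. ennreal (h (A *v (x - m))) \<partial>distr lborel borel ((+) m))"
    by (simp add: lborel_distr_plus)
  also have "\<dots> = (\<integral>\<^sup>+x. ennreal (h (A *v x)) \<partial>lborel)"
    by (subst nn_integral_distr) simp_all
  finally have "ennreal \<bar>det A\<bar> * (\<integral>\<^sup>+x. ennreal (h (A *v (x - m))) \<partial>lborel) = ennreal v"
    using nn_integral_linear_image[OF A, of "\<lambda>x. ennreal (h x)"] h nonneg
    by (simp add: has_bochner_integral_iff nn_integral_eq_integral)
  also have "\<dots> = ennreal \<bar>det A\<bar> * ennreal (v / \<bar>det A\<bar>)"
    using det v by (simp flip: ennreal_mult)
  finally show "(\<integral>\<^sup>+x. ennreal (h (A *v (x - m))) \<partial>lborel) = ennreal (v / \<bar>det A\<bar>)"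
    using det by (simp add: ennreal_mult_cancel_left)
qed

text \<open>Written with \<open>DG\<close> instead of the inverse covariance, so that the
  substitution \<open>y = DG *v (x - m)\<close> reduces every integral to the standard
  Gaussian.\<close>

definition gaussian_potential :: "real ^ 'n ^ 'n \<Rightarrow> real ^ 'n \<Rightarrow> real ^ 'n \<Rightarrow> real" where
  "gaussian_potential DG m x = (norm (DG *v (x - m)))\<^sup>2 / 2"

definition gaussian_norm_const :: "real ^ 'n ^ 'n \<Rightarrow> real" where
  "gaussian_norm_const DG = sqrt (2 * pi) ^ CARD('n) / \<bar>det DG\<bar>"

context
  fixes DG :: "real ^ 'n ^ 'n" and m :: "real ^ 'n"
  assumes DG: "sym_pos_def DG"
begin

lemma gaussian_norm_const_pos: "0 < gaussian_norm_const DG"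
  using sym_pos_def_invertible[OF DG] by (simp add: gaussian_norm_const_def invertible_det_nz)

lemma gaussian_integral:
  "has_bochner_integral lborel (\<lambda>x. exp (- gaussian_potential DG m x)) (gaussian_norm_const DG)"
  using has_bochner_integral_affine_image[OF sym_pos_def_invertible[OF DG] gaussian_total_mass]
  by (simp add: gaussian_potential_def gaussian_norm_const_def)

lemma matrix_inv_square: "matrix_inv (DG ** DG) = matrix_inv DG ** matrix_inv DG"
proof (rule matrix_inv_unique)
  have "DG ** DG ** (matrix_inv DG ** matrix_inv DG) = DG ** (DG ** matrix_inv DG) ** matrix_inv DG"
    by (simp only: matrix_mul_assoc)
  then show "DG ** DG ** (matrix_inv DG ** matrix_inv DG) = mat 1"
    by (simp add: matrix_inv_mult sym_pos_def_invertible[OF DG])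
qed

lemma transpose_matrix_inv: "transpose (matrix_inv DG) = matrix_inv DG"
proof (rule matrix_inv_unique[symmetric])
  have "transpose (matrix_inv DG ** DG) = mat 1"
    by (simp add: matrix_inv_mult sym_pos_def_invertible[OF DG])
  then show "DG ** transpose (matrix_inv DG) = mat 1"
    using DG by (simp only: matrix_transpose_mul sym_pos_def_def)
qed

lemma gaussian_measure_eq:
  "gaussian_measure m (matrix_inv (DG ** DG))
     = density lborel (\<lambda>x. ennreal (exp (- gaussian_potential DG m x) / gaussian_norm_const DG))"
proof -
  have inv: "invertible DG" by (rule sym_pos_def_invertible[OF DG])
  have "matrix_inv (DG ** DG) ** (DG ** DG) = mat 1"
    using inv by (intro matrix_inv_mult) (auto intro: invertible_mult)
  then have minv: "matrix_inv (matrix_inv (DG ** DG)) = DG ** DG"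
    by (rule matrix_inv_unique)
  have "det (matrix_inv DG) * det DG = 1"
    using matrix_inv_mult(2)[OF inv] by (metis det_I det_mul)
  then have "det (matrix_inv (DG ** DG)) = (1 / \<bar>det DG\<bar>)\<^sup>2"
    using inv by (simp add: matrix_inv_square det_mul power2_eq_square field_simps invertible_det_nz)
  moreover have "(sqrt (2 * pi) ^ CARD('n))\<^sup>2 = (2 * pi) ^ CARD('n)"
    by (subst power_mult[symmetric], subst mult.commute, subst power_mult) simp
  ultimately have "(2 * pi) ^ CARD('n) * det (matrix_inv (DG ** DG)) = (gaussian_norm_const DG)\<^sup>2"
    by (simp add: gaussian_norm_const_def power_divide)
  then have const: "sqrt ((2 * pi) ^ CARD('n) * det (matrix_inv (DG ** DG))) = gaussian_norm_const DG"
    using gaussian_norm_const_pos by simp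
  have "y \<bullet> ((DG ** DG) *v y) = (norm (DG *v y))\<^sup>2" for y
  proof -
    have "y \<bullet> (DG *v (DG *v y)) = (transpose DG *v y) \<bullet> (DG *v y)"
      by (simp add: dot_lmul_matrix)
    then show ?thesis
      using DG by (simp only: sym_pos_def_def power2_norm_eq_inner flip: matrix_vector_mul_assoc)
  qed
  then show ?thesis
    unfolding gaussian_measure_def minv const gaussian_potential_def by simp
qed

text \<open>In the variable \<open>y = DG *v (x - m)\<close> the vector \<open>D *v (x - m)\<close>
  is \<open>C *v y\<close> with \<open>C = D ** matrix_inv DG\<close>. By symmetry the transpose of
  \<open>C\<close> is \<open>matrix_inv DG ** D\<close>, with the same operator norm, and cyclicity
  of the trace gives the trace term. The third claim later supplies the sign of
  \<open>T\<close>.\<close>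

lemma gaussian_quartic_moment:
  fixes D :: "real ^ 'n ^ 'n"
  assumes D: "sym_pos_def D"
  defines "T \<equiv> trace (matrix_inv (DG ** DG) ** (D ** D)) + (opnorm (matrix_inv DG ** D))\<^sup>2"
  shows "integrable lborel (\<lambda>x. norm (D *v (x - m)) ^ 4 * exp (- gaussian_potential DG m x))" (is ?I)
    and "(\<integral>x. norm (D *v (x - m)) ^ 4 * exp (- gaussian_potential DG m x) \<partial>lborel) \<le> T\<^sup>2 * gaussian_norm_const DG" (is ?L)
    and "(opnorm (matrix_inv DG ** D))\<^sup>2 \<le> T"
proof -
  have inv: "invertible DG" by (rule sym_pos_def_invertible[OF DG])
  define C where "C = D ** matrix_inv DG"
  have C: "C *v (DG *v y) = D *v y" for y
    using matrix_inv_mult(2)[OF inv]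
    by (simp add: C_def matrix_vector_mul_assoc flip: matrix_mul_assoc)
  have tC: "transpose C = matrix_inv DG ** D"
    using D by (simp add: C_def matrix_transpose_mul transpose_matrix_inv sym_pos_def_def)
  have "trace (C ** transpose C) = trace (D ** (matrix_inv DG ** matrix_inv DG ** D))"
    unfolding tC unfolding C_def by (simp add: matrix_mul_assoc)
  also have "\<dots> = trace (matrix_inv (DG ** DG) ** (D ** D))"
    unfolding matrix_inv_square by (subst trace_mul_sym) (simp add: matrix_mul_assoc)
  finally have T: "T = trace (C ** transpose C) + (opnorm C)\<^sup>2"
    unfolding T_def tC[symmetric] opnorm_transpose by simp
  show "(opnorm (matrix_inv DG ** D))\<^sup>2 \<le> T"
    unfolding T trace_mult_transpose tC[symmetric] opnorm_transpose by (simp add: sum_nonneg)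
  have "has_bochner_integral lborel (\<lambda>x. norm (C *v x) ^ 4 * exp (- (norm x)\<^sup>2 / 2))
      (\<integral>x. norm (C *v x) ^ 4 * exp (- (norm x)\<^sup>2 / 2) \<partial>lborel)"
    by (intro has_bochner_integral_integrable gaussian_quartic_form)
  from has_bochner_integral_affine_image[OF inv this, of m]
  have *: "has_bochner_integral lborel (\<lambda>x. norm (D *v (x - m)) ^ 4 * exp (- gaussian_potential DG m x))
      ((\<integral>x. norm (C *v x) ^ 4 * exp (- (norm x)\<^sup>2 / 2) \<partial>lborel) / \<bar>det DG\<bar>)"
    by (simp add: C gaussian_potential_def)
  then show ?I by (simp add: has_bochner_integral_iff)
  have "(\<integral>x. norm (C *v x) ^ 4 * exp (- (norm x)\<^sup>2 / 2) \<partial>lborel) / \<bar>det DG\<bar>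
      \<le> (T\<^sup>2 * sqrt (2 * pi) ^ CARD('n)) / \<bar>det DG\<bar>"
    unfolding T by (intro divide_right_mono gaussian_quartic_form) auto
  then show ?L using * by (simp add: has_bochner_integral_iff gaussian_norm_const_def)
qed

end

subsection \<open>Second-order estimates\<close>

lemma second_order_lower_bound:
  fixes \<phi> :: "real \<Rightarrow> real"
  assumes d1: "\<And>t. 0 \<le> t \<Longrightarrow> t \<le> 1 \<Longrightarrow> (\<phi> has_real_derivative \<phi>' t) (at t)"
    and d2: "\<And>t. 0 \<le> t \<Longrightarrow> t \<le> 1 \<Longrightarrow> (\<phi>' has_real_derivative \<phi>'' t) (at t)"
    and le: "\<And>t. 0 \<le> t \<Longrightarrow> t \<le> 1 \<Longrightarrow> k \<le> \<phi>'' t"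
  shows "\<phi> 0 + \<phi>' 0 + k / 2 \<le> \<phi> 1"
proof -
  have slope: "k * t \<le> \<phi>' t - \<phi>' 0" if t: "0 \<le> t" "t \<le> 1" for t
  proof -
    have "\<phi>' 0 - k * 0 \<le> \<phi>' t - k * t"
    proof (rule DERIV_nonneg_imp_nondecreasing[OF t(1)])
      fix s assume s: "0 \<le> s" "s \<le> t"
      have "((\<lambda>t. \<phi>' t - k * t) has_real_derivative \<phi>'' s - k) (at s)"
        using s t by (auto intro!: derivative_eq_intros d2)
      then show "\<exists>y. ((\<lambda>t. \<phi>' t - k * t) has_real_derivative y) (at s) \<and> 0 \<le> y"
        using le[of s] s t by (intro exI[of _ "\<phi>'' s - k"]) auto
    qed
    then show ?thesis by simp
  qed
  have "\<phi> 0 - \<phi>' 0 * 0 - k * 0\<^sup>2 / 2 \<le> \<phi> 1 - \<phi>' 0 * 1 - k * 1\<^sup>2 / 2"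
  proof (rule DERIV_nonneg_imp_nondecreasing[of 0 1])
    fix s :: real assume s: "0 \<le> s" "s \<le> 1"
    have "((\<lambda>t. \<phi> t - \<phi>' 0 * t - k * t\<^sup>2 / 2) has_real_derivative \<phi>' s - \<phi>' 0 - k * s) (at s)"
      using s by (auto intro!: derivative_eq_intros d1)
    then show "\<exists>y. ((\<lambda>t. \<phi> t - \<phi>' 0 * t - k * t\<^sup>2 / 2) has_real_derivative y) (at s) \<and> 0 \<le> y"
      using slope[OF s] by (intro exI[of _ "\<phi>' s - \<phi>' 0 - k * s"]) auto
  qed simp
  then show ?thesis by simp
qed

text \<open>Meant for a slope that vanishes at the start of a segment and grows at most linearly:
  integrating \<open>k * t\<close> gives the factor 1/2.\<close>

lemma linear_slope_upper_bound:
  fixes \<psi> :: "real \<Rightarrow> real"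
  assumes d: "\<And>t. 0 \<le> t \<Longrightarrow> t \<le> 1 \<Longrightarrow> (\<psi> has_real_derivative \<psi>' t) (at t)"
    and le: "\<And>t. 0 \<le> t \<Longrightarrow> t \<le> 1 \<Longrightarrow> \<psi>' t \<le> k * t"
  shows "\<psi> 1 \<le> \<psi> 0 + k / 2"
proof -
  have "k * 0\<^sup>2 / 2 - \<psi> 0 \<le> k * 1\<^sup>2 / 2 - \<psi> 1"
  proof (rule DERIV_nonneg_imp_nondecreasing[of 0 1])
    fix s :: real assume s: "0 \<le> s" "s \<le> 1"
    have "((\<lambda>t. k * t\<^sup>2 / 2 - \<psi> t) has_real_derivative k * s - \<psi>' s) (at s)"
      using s by (auto intro!: derivative_eq_intros d)
    then show "\<exists>y. ((\<lambda>t. k * t\<^sup>2 / 2 - \<psi> t) has_real_derivative y) (at s) \<and> 0 \<le> y"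
      using le[OF s] by (intro exI[of _ "k * s - \<psi>' s"]) auto
  qed simp
  then show ?thesis by simp
qed

section \<open>Derivatives along segments, and norms weighted by \<open>DG\<close> and
  \<open>D\<close>\<close>

lemma has_derivative_gradient:
  fixes f :: "real ^ 'n \<Rightarrow> real"
  assumes "f differentiable (at x)"
  shows "(f has_derivative (\<lambda>h. gradient f x \<bullet> h)) (at x)"
proof -
  have D: "(f has_derivative frechet_derivative f (at x)) (at x)"
    using assms by (simp add: frechet_derivative_works)
  then have lin: "linear (frechet_derivative f (at x))"
    by (rule has_derivative_linear)
  have "frechet_derivative f (at x) h = gradient f x \<bullet> h" for h
  proof -
    have "frechet_derivative f (at x) h = frechet_derivative f (at x) (\<Sum>i\<in>UNIV. (h $ i) *\<^sub>R axis i 1)"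
      by (simp add: basis_expansion flip: scalar_mult_eq_scaleR)
    also have "\<dots> = gradient f x \<bullet> h"
      using lin by (simp add: linear_sum linear_cmul gradient_def inner_vec_def mult.commute)
    finally show ?thesis .
  qed
  then have "frechet_derivative f (at x) = (\<lambda>h. gradient f x \<bullet> h)" by blast
  with D show ?thesis by simp
qed

lemma has_derivative_hessian:
  fixes f :: "real ^ 'n \<Rightarrow> real"
  assumes "gradient f differentiable (at x)"
  shows "(gradient f has_derivative (\<lambda>h. hessian f x *v h)) (at x)"
proof -
  have D: "(gradient f has_derivative frechet_derivative (gradient f) (at x)) (at x)"
    using assms by (simp add: frechet_derivative_works)
  then show ?thesis
    by (simp add: hessian_def has_derivative_linear[OF D])
qed

lemma has_real_derivative_along_line:
  fixes g :: "'a::real_normed_vector \<Rightarrow> real"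
  assumes "(g has_derivative g') (at (x + t *\<^sub>R h))"
  shows "((\<lambda>t. g (x + t *\<^sub>R h)) has_real_derivative g' h) (at t)"
proof -
  have "((\<lambda>t. x + t *\<^sub>R h) has_derivative (\<lambda>s. s *\<^sub>R h)) (at t)"
    by (auto intro!: derivative_eq_intros)
  from has_derivative_compose[OF this assms]
  have "((\<lambda>t. g (x + t *\<^sub>R h)) has_derivative (\<lambda>s. g' (s *\<^sub>R h))) (at t)" .
  moreover have "g' (s *\<^sub>R h) = g' h * s" for s
    using linear_cmul[OF has_derivative_linear[OF assms]] by simp
  ultimately show ?thesis by (simp add: has_field_derivative_def)
qed

lemma inner_sym_matrix:
  fixes A :: "real ^ 'n ^ 'n"
  assumes "sym_pos_def A"
  shows "x \<bullet> (A *v y) = (A *v x) \<bullet> y"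
proof -
  have "x \<bullet> (A *v y) = (transpose A *v x) \<bullet> y"
    by (simp add: dot_lmul_matrix)
  then show ?thesis using assms by (simp only: sym_pos_def_def)
qed

lemma matrix_inv_cancel:
  fixes A :: "real ^ 'n ^ 'n"
  assumes "sym_pos_def A"
  shows "matrix_inv A *v (A *v x) = x" "A *v (matrix_inv A *v x) = x"
  using matrix_inv_mult[OF sym_pos_def_invertible[OF assms]] by (simp_all add: matrix_vector_mul_assoc)

lemma inner_sym_matrix_inv:
  fixes A :: "real ^ 'n ^ 'n"
  assumes "sym_pos_def A"
  shows "x \<bullet> (matrix_inv A *v y) = (matrix_inv A *v x) \<bullet> y"
  by (metis assms inner_sym_matrix matrix_inv_cancel(2))

text \<open>By symmetry the squared norm of \<open>B *v x\<close> is the inner product of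
  \<open>matrix_inv A *v (B *v (B *v x))\<close> with \<open>A *v x\<close>; Cauchy--Schwarz and
  cancellation finish. For \<open>A = DG\<close> and \<open>B = D\<close> the factor is
  \<open>alpha DG D\<close>.\<close>

lemma norm_scaled_le:
  fixes A B :: "real ^ 'n ^ 'n"
  assumes A: "sym_pos_def A" and B: "sym_pos_def B"
  shows "norm (B *v x) \<le> opnorm (matrix_inv A ** B) * norm (A *v x)"
proof -
  have "(norm (B *v x))\<^sup>2 = (matrix_inv A *v (B *v (B *v x))) \<bullet> (A *v x)"
    by (simp add: power2_norm_eq_inner inner_sym_matrix[OF A, symmetric] inner_sym_matrix[OF B] matrix_inv_cancel[OF A]
        inner_commute[of "matrix_inv A *v _"] flip: inner_sym_matrix_inv[OF A])
  also have "\<dots> \<le> norm ((matrix_inv A ** B) *v (B *v x)) * norm (A *v x)"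
    unfolding matrix_vector_mul_assoc[symmetric] by (rule norm_cauchy_schwarz)
  also have "\<dots> \<le> (opnorm (matrix_inv A ** B) * norm (B *v x)) * norm (A *v x)"
    by (intro mult_right_mono opnorm_mult_vec) auto
  finally have "norm (B *v x) * norm (B *v x) \<le> (opnorm (matrix_inv A ** B) * norm (A *v x)) * norm (B *v x)"
    by (simp add: power2_eq_square mult_ac)
  then show ?thesis
    using opnorm_nonneg[of "matrix_inv A ** B"] by (cases "norm (B *v x) = 0") (auto simp: mult_le_cancel_right)
qed

lemma alpha_pos:
  assumes A: "sym_pos_def A" and B: "sym_pos_def B"
  shows "0 < alpha A B"
proof (rule ccontr)
  assume "\<not> 0 < alpha A B"
  then have "alpha A B = 0"
    using opnorm_nonneg[of "matrix_inv A ** B"] by (simp add: alpha_def)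
  then have "norm (B *v axis undefined 1) \<le> 0"
    using norm_scaled_le[OF A B, of "axis undefined 1"] by (simp add: alpha_def)
  moreover have "B *v axis undefined 1 \<noteq> 0"
    using B unfolding sym_pos_def_def by (metis axis_eq_0_iff inner_zero_right less_irrefl zero_neq_one)
  ultimately show False by simp
qed

text \<open>\<open>hess_dev\<close> is the norm of the Hessian deviation as a bilinear form when
  vectors are measured by |D k|: inserting \<open>matrix_inv D\<close> and \<open>D\<close> on both
  sides changes nothing.\<close>

lemma hess_dev_bound:
  fixes f :: "real ^ 'n \<Rightarrow> real"
  assumes D: "sym_pos_def D"
  shows "\<bar>k \<bullet> ((hessian f x - hessian f m) *v h)\<bar> \<le> hess_dev f m D x * norm (D *v k) * norm (D *v h)"
proof -
  let ?M = "matrix_inv D ** (hessian f x - hessian f m) ** matrix_inv D"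
  have "k \<bullet> ((hessian f x - hessian f m) *v h) = (D *v k) \<bullet> (?M *v (D *v h))"
    by (simp only: matrix_vector_mul_assoc[symmetric] matrix_inv_cancel[OF D] inner_sym_matrix_inv[OF D])
  also have "\<bar>\<dots>\<bar> \<le> norm (D *v k) * norm (?M *v (D *v h))"
    by (rule Cauchy_Schwarz_ineq2)
  also have "\<dots> \<le> norm (D *v k) * (hess_dev f m D x * norm (D *v h))"
    unfolding hess_dev_def by (intro mult_left_mono opnorm_mult_vec) auto
  finally show ?thesis by (simp add: mult_ac)
qed

subsection \<open>Total variation and the Hellinger affinity\<close>

text \<open>Cauchy--Schwarz for |p - q| = |sqrt p - sqrt q| (sqrt p + sqrt q): the squares of the
  factors integrate to 2 - 2c and 2 + 2c, with product 4 (1 - c^2).\<close>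

lemma hellinger_bound:
  fixes p q :: "'a \<Rightarrow> real"
  assumes int: "integrable M p" "integrable M q" and nonneg: "\<And>x. 0 \<le> p x" "\<And>x. 0 \<le> q x"
    and one: "(\<integral>x. p x \<partial>M) = 1" "(\<integral>x. q x \<partial>M) = 1"
    and A [measurable]: "A \<in> sets M"
  shows "\<bar>(\<integral>x. indicator A x * p x \<partial>M) - (\<integral>x. indicator A x * q x \<partial>M)\<bar>
      \<le> sqrt (1 - (\<integral>x. sqrt (p x * q x) \<partial>M)\<^sup>2)"
proof -
  have [measurable]: "p \<in> borel_measurable M" "q \<in> borel_measurable M"
    using int by auto
  define c where "c = (\<integral>x. sqrt (p x * q x) \<partial>M)"
  define E where "E = (\<integral>x. \<bar>p x - q x\<bar> \<partial>M)"
  have ic: "integrable M (\<lambda>x. sqrt (p x * q x))"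
  proof (rule Bochner_Integration.integrable_bound)
    show "integrable M (\<lambda>x. p x + q x)" using int by simp
    have "sqrt (p x * q x) \<le> p x + q x" for x
      using arith_geo_mean_sqrt[of "p x" "q x"] nonneg[of x] by simp
    then show "AE x in M. norm (sqrt (p x * q x)) \<le> norm (p x + q x)"
      using nonneg by auto
  qed measurable
  have sq: "(sqrt (p x) - sqrt (q x))\<^sup>2 = p x + q x - 2 * sqrt (p x * q x)"
      "(sqrt (p x) + sqrt (q x))\<^sup>2 = p x + q x + 2 * sqrt (p x * q x)" for x
    using nonneg[of x] by (simp_all add: power2_diff power2_sum real_sqrt_mult)
  have minus: "has_bochner_integral M (\<lambda>x. (sqrt (p x) - sqrt (q x))\<^sup>2) (2 - 2 * c)"
    unfolding sq using int ic one by (simp add: has_bochner_integral_iff c_def)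
  have plus: "has_bochner_integral M (\<lambda>x. (sqrt (p x) + sqrt (q x))\<^sup>2) (2 + 2 * c)"
    unfolding sq using int ic one by (simp add: has_bochner_integral_iff c_def)
  have nn: "(\<integral>\<^sup>+x. ennreal (h x) ^ 2 \<partial>M) = ennreal v"
    if "has_bochner_integral M (\<lambda>x. (h x)\<^sup>2) v" "\<And>x. 0 \<le> h x" for h v
    using that by (simp add: ennreal_power has_bochner_integral_iff nn_integral_eq_integral)
  have bounds: "0 \<le> 2 - 2 * c" "0 \<le> 2 + 2 * c"
    unfolding has_bochner_integral_integral_eq[OF minus, symmetric] has_bochner_integral_integral_eq[OF plus, symmetric]
    by (rule Bochner_Integration.integral_nonneg, simp)+
  have "\<bar>p x - q x\<bar> = \<bar>sqrt (p x) - sqrt (q x)\<bar> * (sqrt (p x) + sqrt (q x))" for x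
  proof -
    have "p x - q x = (sqrt (p x) - sqrt (q x)) * (sqrt (p x) + sqrt (q x))"
      using nonneg[of x] by (simp add: algebra_simps)
    then show ?thesis using nonneg[of x] by (simp add: abs_mult)
  qed
  moreover have "ennreal E = (\<integral>\<^sup>+x. ennreal \<bar>p x - q x\<bar> \<partial>M)"
    unfolding E_def using int by (subst nn_integral_eq_integral) simp_all
  ultimately have "ennreal E = (\<integral>\<^sup>+x. ennreal \<bar>sqrt (p x) - sqrt (q x)\<bar> * ennreal (sqrt (p x) + sqrt (q x)) \<partial>M)"
    using nonneg by (simp add: ennreal_mult)
  then have "(ennreal E)\<^sup>2 \<le> ennreal (2 - 2 * c) * ennreal (2 + 2 * c)"
    using Cauchy_Schwarz_nn_integral[of "\<lambda>x. ennreal \<bar>sqrt (p x) - sqrt (q x)\<bar>" M "\<lambda>x. ennreal (sqrt (p x) + sqrt (q x))"]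
      minus plus nonneg by (simp add: nn del: ennreal_plus)
  then have "E\<^sup>2 \<le> (2 - 2 * c) * (2 + 2 * c)"
    using bounds by (simp add: ennreal_power E_def ennreal_le_iff flip: ennreal_mult)
  then have "(E / 2)\<^sup>2 \<le> 1 - c\<^sup>2"
    by (simp add: power2_eq_square field_simps)
  then have E: "E / 2 \<le> sqrt (1 - c\<^sup>2)"
    by (rule real_le_rsqrt)
  have iA: "integrable M (\<lambda>x. indicator A x * p x)" "integrable M (\<lambda>x. indicator A x * q x)"
    using int by (auto intro: integrable_real_mult_indicator simp: mult.commute)
  define X where "X = (\<integral>x. indicator A x * p x \<partial>M) - (\<integral>x. indicator A x * q x \<partial>M)"
  \<comment> \<open>Subtracting the integral of \<open>p - q\<close>, which is 0, makes the
    integrand equal to \<open>p - q\<close> on \<open>A\<close> and to its negative elsewhere; hence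
    half the L1 distance suffices.\<close>
  have X: "2 * X = (\<integral>x. 2 * (indicator A x * p x) - 2 * (indicator A x * q x) - p x + q x \<partial>M)"
    using int iA one unfolding X_def by simp
  have "\<bar>2 * X\<bar> \<le> (\<integral>x. \<bar>2 * (indicator A x * p x) - 2 * (indicator A x * q x) - p x + q x\<bar> \<partial>M)"
    unfolding X by (rule integral_abs_bound)
  also have "\<dots> = E"
  proof -
    have "\<bar>2 * (indicator A x * p x) - 2 * (indicator A x * q x) - p x + q x\<bar> = \<bar>p x - q x\<bar>" for x
      by (cases "x \<in> A") simp_all
    then show ?thesis unfolding E_def by simp
  qed
  finally have "\<bar>X\<bar> \<le> E / 2" by linarith
  then show ?thesis
    using E unfolding X_def c_def by linarith
qed

lemma measure_density_lborel:
  fixes d :: "'a::euclidean_space \<Rightarrow> real"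
  assumes d: "integrable lborel d" "\<And>x. 0 \<le> d x" and A: "A \<in> sets borel"
  shows "measure (density lborel (\<lambda>x. ennreal (d x))) A = (\<integral>x. indicator A x * d x \<partial>lborel)"
proof -
  have int: "integrable lborel (\<lambda>x. indicator A x * d x)"
    using integrable_real_mult_indicator[of A lborel d] d A by (simp add: mult.commute)
  have "emeasure (density lborel (\<lambda>x. ennreal (d x))) A = (\<integral>\<^sup>+x. ennreal (indicator A x * d x) \<partial>lborel)"
    using d A by (subst emeasure_density) (auto intro!: nn_integral_cong simp: indicator_def)
  also have "\<dots> = ennreal (\<integral>x. indicator A x * d x \<partial>lborel)"
    using int d by (intro nn_integral_eq_integral) auto
  finally show ?thesis
    using d by (simp add: measure_def)
qed

lemma prob_space_density_lborel:
  fixes d :: "'a::euclidean_space \<Rightarrow> real"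
  assumes d: "integrable lborel d" "\<And>x. 0 \<le> d x" "(\<integral>x. d x \<partial>lborel) = 1"
  shows "prob_space (density lborel (\<lambda>x. ennreal (d x)))"
proof
  have "(\<integral>\<^sup>+x. ennreal (d x) \<partial>lborel) = 1"
    using d by (subst nn_integral_eq_integral) auto
  then show "emeasure (density lborel (\<lambda>x. ennreal (d x))) (space (density lborel (\<lambda>x. ennreal (d x)))) = 1"
    using d by (simp add: emeasure_density)
qed

text \<open>With masses p, s of \<open>U\<close> and conditional probabilities a, b of
  \<open>A\<close>, the difference is at most p a + (1 - p) - s b = p (a - b) + (p - s) b + (1 - p),
  where (p - s) b \<le> 1 - s. One-sided, so that exchanging the measures gives the absolute
  value.\<close>

lemma measure_diff_le_conditional:
  assumes P: "prob_space P" and Q: "prob_space Q" and sets: "sets P = sets borel" "sets Q = sets borel"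
    and A: "A \<in> sets borel" and U: "U \<in> sets borel" and pos: "0 < measure P U" "0 < measure Q U"
    and e: "measure P (A \<inter> U) / measure P U - measure Q (A \<inter> U) / measure Q U \<le> e" "0 \<le> e"
  shows "measure P A - measure Q A \<le> e + measure P (- U) + measure Q (- U)"
proof -
  interpret P: prob_space P by fact
  interpret Q: prob_space Q by fact
  have space: "space P = UNIV" "space Q = UNIV"
    using sets_eq_imp_space_eq[OF sets(1)] sets_eq_imp_space_eq[OF sets(2)] by auto
  define p where "p = measure P U"
  define s where "s = measure Q U"
  define a where "a = measure P (A \<inter> U) / p"
  define b where "b = measure Q (A \<inter> U) / s"
  have comp: "measure P (- U) = 1 - p" "measure Q (- U) = 1 - s"
    using P.prob_compl[of U] Q.prob_compl[of U] U by (simp_all add: space sets p_def s_def Compl_eq_Diff_UNIV)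
  have "(A \<inter> U) \<union> (A \<inter> - U) = A" by blast
  then have "measure P A = measure P (A \<inter> U) + measure P (A \<inter> - U)"
    using P.finite_measure_Union[of "A \<inter> U" "A \<inter> - U"] A U sets by auto
  also have "measure P (A \<inter> - U) \<le> measure P (- U)"
    using U sets by (intro P.finite_measure_mono) auto
  finally have PA: "measure P A \<le> p * a + (1 - p)"
    using pos comp by (simp add: a_def p_def)
  have "measure Q (A \<inter> U) \<le> measure Q A"
    using A sets by (intro Q.finite_measure_mono) auto
  then have QA: "s * b \<le> measure Q A"
    using pos by (simp add: b_def s_def)
  have "measure Q (A \<inter> U) \<le> measure Q U"
    using U sets by (intro Q.finite_measure_mono) auto
  then have b: "0 \<le> b" "b \<le> 1" using pos by (auto simp: b_def s_def)
  have p: "0 \<le> p" "p \<le> 1" and s: "s \<le> 1" using pos by (auto simp: p_def s_def)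
  have "p * (a - b) \<le> p * e"
    using e(1) p by (intro mult_left_mono) (auto simp: a_def b_def p_def s_def)
  also have "p * e \<le> e" using p e(2) by (simp add: mult_left_le_one_le)
  finally have 1: "p * a - p * b \<le> e" by (simp add: right_diff_distrib)
  have "p * b \<le> 1 * b" using p b by (intro mult_right_mono) auto
  moreover have "(1 - s) * b \<le> (1 - s) * 1" using s b by (intro mult_left_mono) auto
  ultimately have "p * b - s * b \<le> 1 - s" by (simp add: algebra_simps)
  then show ?thesis
    using PA QA comp 1 by linarith
qed

text \<open>Boundedness of \<open>U\<close> makes \<open>g = exp (r / 2)\<close>, \<open>r = f - q\<close>, and its gradient bounded, as the Poincare
  inequality requires; a general \<open>U\<close> is exhausted by its intersections with balls around \<open>m\<close>.\<close>

context
  fixes f :: "real ^ 'n \<Rightarrow> real" and m :: "real ^ 'n" and DG D :: "real ^ 'n ^ 'n"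
    and U :: "(real ^ 'n) set" and w \<tau> l :: real
  assumes f_diff: "thrice_differentiable f"
    and f_min: "\<And>x. f m \<le> f x"
    and f_int: "integrable lborel (\<lambda>x. exp (- f x))"
    and DG_pos: "sym_pos_def DG" and DG_sq: "DG ** DG = hessian f m" and D_pos: "sym_pos_def D"
    and U [measurable]: "U \<in> sets borel" and U_convex: "convex U" and U_bounded: "bounded U" and m_U: "m \<in> U"
    and w: "\<And>x. x \<in> U \<Longrightarrow> hess_dev f m D x \<le> w"
    and \<tau>: "\<And>x. x \<in> U \<Longrightarrow> hess_dev f m D x \<le> \<tau> * norm (D *v (x - m))"
    and \<tau>_nonneg: "0 \<le> \<tau>" and l: "l = 1 / (alpha DG D)\<^sup>2 - w" and l_pos: "0 < l"
begin

private abbreviation q where "q \<equiv> gaussian_potential DG m"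
private definition r where "r x = f x - q x"
private definition gr where "gr x = gradient f x - DG *v (DG *v (x - m))"
private definition g where "g x = exp (r x / 2)"
text \<open>The gradient of \<open>g\<close> multiplied by \<open>matrix_inv D\<close>: then
  \<open>h x \<bullet> (D *v k)\<close> is the derivative of \<open>g\<close> along
  \<open>k\<close>, so that the Poincare inequality can be applied with \<open>T\<close> equal to
  \<open>D\<close>.\<close>

private definition h where "h x = (g x / 2) *\<^sub>R (matrix_inv D *v gr x)"

lemma f_has_derivative: "(f has_derivative (\<lambda>h. gradient f x \<bullet> h)) (at x)"
  using f_diff by (intro has_derivative_gradient) (simp add: thrice_differentiable_def)

lemma gradient_has_derivative: "(gradient f has_derivative (\<lambda>h. hessian f x *v h)) (at x)"
  using f_diff by (intro has_derivative_hessian) (simp add: thrice_differentiable_def)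

private lemma r_has_derivative: "(r has_derivative (\<lambda>h. gr x \<bullet> h)) (at x)"
proof -
  have 1: "((\<lambda>x. DG *v (x - m)) has_derivative (\<lambda>h. DG *v h)) (at x)"
    by (rule bounded_linear.has_derivative[OF matrix_vector_mul_bounded_linear])
       (auto intro!: derivative_eq_intros)
  have "((\<lambda>x. f x - 1 / 2 * ((DG *v (x - m)) \<bullet> (DG *v (x - m)))) has_derivative
      (\<lambda>h. gradient f x \<bullet> h - 1 / 2 * ((DG *v (x - m)) \<bullet> (DG *v h) + (DG *v h) \<bullet> (DG *v (x - m))))) (at x)"
    by (intro has_derivative_diff f_has_derivative has_derivative_mult_right has_derivative_inner 1)
  moreover have "gradient f x \<bullet> h - 1 / 2 * ((DG *v (x - m)) \<bullet> (DG *v h) + (DG *v h) \<bullet> (DG *v (x - m))) = gr x \<bullet> h" for h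
    using inner_sym_matrix[OF DG_pos, of "DG *v (x - m)" h]
    by (simp add: gr_def inner_diff_left inner_commute[of "DG *v h" "DG *v (x - m)"])
  ultimately show ?thesis
    by (simp add: r_def[abs_def] gaussian_potential_def power2_norm_eq_inner)
qed

private lemma gr_has_derivative: "(gr has_derivative (\<lambda>h. (hessian f x - hessian f m) *v h)) (at x)"
proof -
  have 1: "((\<lambda>x. DG *v (DG *v (x - m))) has_derivative (\<lambda>h. DG *v (DG *v h))) (at x)"
    by (intro bounded_linear.has_derivative[OF matrix_vector_mul_bounded_linear])
       (auto intro!: derivative_eq_intros)
  have "(gr has_derivative (\<lambda>h. hessian f x *v h - DG *v (DG *v h))) (at x)"
    unfolding gr_def[abs_def] by (intro has_derivative_diff gradient_has_derivative 1)
  then show ?thesis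
    by (simp add: matrix_vector_mul_assoc DG_sq matrix_vector_mult_diff_rdistrib)
qed

private lemma continuous_gr: "continuous_on S gr"
  by (rule has_derivative_continuous_on, rule has_derivative_at_withinI, rule gr_has_derivative)

private lemma continuous_r: "continuous_on S r"
  by (rule has_derivative_continuous_on, rule has_derivative_at_withinI, rule r_has_derivative)

lemma continuous_f: "continuous_on S f"
  by (rule has_derivative_continuous_on, rule has_derivative_at_withinI, rule f_has_derivative)

private lemma gr_m: "gr m = 0"
proof -
  have "(\<lambda>h. gradient f m \<bullet> h) = (\<lambda>h. 0)"
    using f_min by (intro differential_zero_maxmin[OF _ open_UNIV f_has_derivative]) auto
  then have "gradient f m \<bullet> gradient f m = 0" by metis
  then show ?thesis by (simp add: gr_def)
qed

private lemma segment_U: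
  assumes "x \<in> U" "y \<in> U" "0 \<le> t" "t \<le> (1::real)"
  shows "x + t *\<^sub>R (y - x) \<in> U"
  using convexD_alt[OF U_convex assms] by (simp add: algebra_simps)

text \<open>The origin of \<lambda>: at \<open>m\<close> the Hessian form is the squared norm of
  \<open>DG *v k\<close>, at least \<open>1 / (alpha DG D)\<^sup>2\<close> times that of
  \<open>D *v k\<close>; moving to another point of \<open>U\<close> costs at most \<open>w\<close>
  times the latter.\<close>

private lemma hessian_ge:
  assumes "x \<in> U"
  shows "l * (norm (D *v k))\<^sup>2 \<le> (hessian f x *v k) \<bullet> k"
proof -
  define a where "a = alpha DG D"
  have a: "0 < a" unfolding a_def by (rule alpha_pos[OF DG_pos D_pos])
  have "(norm (D *v k))\<^sup>2 \<le> (a * norm (DG *v k))\<^sup>2"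
    unfolding a_def alpha_def by (intro power_mono norm_scaled_le DG_pos D_pos) auto
  then have "1 / a\<^sup>2 * (norm (D *v k))\<^sup>2 \<le> (norm (DG *v k))\<^sup>2"
    using a by (simp add: power_mult_distrib field_simps)
  also have "\<dots> = (hessian f m *v k) \<bullet> k"
    by (simp add: power2_norm_eq_inner inner_sym_matrix[OF DG_pos] flip: DG_sq matrix_vector_mul_assoc)
  finally have 1: "1 / a\<^sup>2 * (norm (D *v k))\<^sup>2 \<le> (hessian f m *v k) \<bullet> k" .
  have "\<bar>k \<bullet> ((hessian f x - hessian f m) *v k)\<bar> \<le> w * (norm (D *v k))\<^sup>2"
    using hess_dev_bound[OF D_pos, of k f x m k] mult_right_mono[OF w[OF assms], of "(norm (D *v k))\<^sup>2"]
    by (simp add: power2_eq_square mult_ac)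
  then have "- (w * (norm (D *v k))\<^sup>2) \<le> (hessian f x *v k) \<bullet> k - (hessian f m *v k) \<bullet> k"
    by (simp add: matrix_vector_mult_diff_rdistrib inner_diff_right inner_commute)
  with 1 show ?thesis by (simp add: l a_def algebra_simps)
qed

text \<open>Second-order expansion at the midpoint in the directions \<open>k\<close> and
  \<open>- k\<close>: the gradient terms cancel, and each side gains \<open>l / 2\<close> times the
  squared norm of \<open>D *v k\<close>, which is a quarter of that of
  \<open>D *v (y - x)\<close>.\<close>

lemma f_strongly_convex:
  assumes "x \<in> U" "y \<in> U"
  shows "2 * f ((1 / 2) *\<^sub>R (x + y)) + l / 4 * (norm (D *v (y - x)))\<^sup>2 \<le> f x + f y"
proof -
  define z where "z = (1 / 2) *\<^sub>R (x + y)"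
  have zU: "z \<in> U"
  proof -
    have "z = x + (1 / 2) *\<^sub>R (y - x)" by (simp add: z_def vec_eq_iff field_simps)
    then show ?thesis using segment_U[OF assms, of "1 / 2"] by simp
  qed
  have lower: "f z + gradient f z \<bullet> k + l * (norm (D *v k))\<^sup>2 / 2 \<le> f (z + k)" if "z + k \<in> U" for k
  proof -
    have "f (z + 0 *\<^sub>R k) + gradient f (z + 0 *\<^sub>R k) \<bullet> k + l * (norm (D *v k))\<^sup>2 / 2 \<le> f (z + 1 *\<^sub>R k)"
    proof (rule second_order_lower_bound)
      fix t :: real assume t: "0 \<le> t" "t \<le> 1"
      show "((\<lambda>t. f (z + t *\<^sub>R k)) has_real_derivative gradient f (z + t *\<^sub>R k) \<bullet> k) (at t)"
        by (rule has_real_derivative_along_line[OF f_has_derivative])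
      show "((\<lambda>t. gradient f (z + t *\<^sub>R k) \<bullet> k) has_real_derivative (hessian f (z + t *\<^sub>R k) *v k) \<bullet> k) (at t)"
        by (rule has_real_derivative_along_line[where g = "\<lambda>x. gradient f x \<bullet> k"])
           (rule has_derivative_inner_left[OF gradient_has_derivative])
      show "l * (norm (D *v k))\<^sup>2 \<le> (hessian f (z + t *\<^sub>R k) *v k) \<bullet> k"
        using segment_U[OF zU that t] by (intro hessian_ge) simp
    qed
    then show ?thesis by simp
  qed
  define k where "k = (1 / 2) *\<^sub>R (y - x)"
  have zk: "z + k = y" "z + - k = x"
    by (simp_all add: z_def k_def vec_eq_iff field_simps)
  have Dk: "norm (D *v k) = norm (D *v (y - x)) / 2"
    by (simp add: k_def matrix_vector_mult_scaleR)
  have Dk': "norm (D *v - k) = norm (D *v (y - x)) / 2"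
    unfolding Dk[symmetric] by (simp add: linear_neg[OF matrix_vector_mul_linear])
  then show ?thesis
    using lower[of k] lower[of "- k"] assms unfolding zk Dk Dk' z_def[symmetric]
    by (simp add: power_divide)
qed

text \<open>\<open>gr\<close> vanishes at \<open>m\<close>, and at parameter \<open>t\<close> of the
  segment to \<open>x\<close> the Hessian deviation is at most
  \<open>\<tau> * t * norm (D *v (x - m))\<close>. Integrating over \<open>t\<close> gives
  \<tau>/2.\<close>

private lemma norm_gr_le:
  assumes x: "x \<in> U"
  shows "norm (matrix_inv D *v gr x) \<le> \<tau> / 2 * (norm (D *v (x - m)))\<^sup>2"
proof -
  define k where "k = x - m"
  \<comment> \<open>The test vector that recovers the norm: \<open>gr x \<bullet> e\<close> is the
    squared norm of \<open>matrix_inv D *v gr x\<close>, and \<open>D *v e\<close> is that vector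
    itself.\<close>
  define e where "e = matrix_inv D *v (matrix_inv D *v gr x)"
  define \<psi> where "\<psi> t = gr (m + t *\<^sub>R k) \<bullet> e" for t
  have De: "D *v e = matrix_inv D *v gr x"
    by (simp add: e_def matrix_inv_cancel[OF D_pos])
  have "\<psi> 1 \<le> \<psi> 0 + (\<tau> * (norm (D *v k))\<^sup>2 * norm (D *v e)) / 2"
  proof (rule linear_slope_upper_bound)
    fix t :: real assume t: "0 \<le> t" "t \<le> 1"
    show "(\<psi> has_real_derivative ((hessian f (m + t *\<^sub>R k) - hessian f m) *v k) \<bullet> e) (at t)"
      unfolding \<psi>_def
      by (rule has_real_derivative_along_line[where g = "\<lambda>x. gr x \<bullet> e"])
         (rule has_derivative_inner_left[OF gr_has_derivative])
    have tU: "m + t *\<^sub>R k \<in> U" using segment_U[OF m_U x t] by (simp add: k_def)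
    have "((hessian f (m + t *\<^sub>R k) - hessian f m) *v k) \<bullet> e
        \<le> hess_dev f m D (m + t *\<^sub>R k) * norm (D *v e) * norm (D *v k)"
      using hess_dev_bound[OF D_pos, of e f "m + t *\<^sub>R k" m k] by (simp add: inner_commute)
    also have "\<dots> \<le> (\<tau> * norm (D *v (m + t *\<^sub>R k - m))) * norm (D *v e) * norm (D *v k)"
      by (intro mult_right_mono \<tau> tU) auto
    also have "\<dots> = \<tau> * (norm (D *v k))\<^sup>2 * norm (D *v e) * t"
      using t by (simp add: matrix_vector_mult_scaleR power2_eq_square)
    finally show "((hessian f (m + t *\<^sub>R k) - hessian f m) *v k) \<bullet> e
        \<le> \<tau> * (norm (D *v k))\<^sup>2 * norm (D *v e) * t" .
  qed
  moreover have "\<psi> 0 = 0" by (simp add: \<psi>_def gr_m)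
  moreover have "\<psi> 1 = norm (D *v e) * norm (D *v e)"
    unfolding De by (simp add: \<psi>_def k_def e_def inner_sym_matrix_inv[OF D_pos] flip: power2_eq_square power2_norm_eq_inner)
  ultimately have "norm (D *v e) * norm (D *v e) \<le> (\<tau> / 2 * (norm (D *v k))\<^sup>2) * norm (D *v e)"
    by simp
  then show ?thesis
    using \<tau>_nonneg unfolding De[symmetric] k_def[symmetric]
    by (cases "norm (D *v e) = 0") (auto simp: mult_le_cancel_right)
qed

private lemma g_bounded: "\<exists>B. \<forall>x\<in>U. \<bar>g x\<bar> \<le> B \<and> (norm (h x))\<^sup>2 \<le> B"
proof -
  have cl: "compact (closure U)" using U_bounded by (simp add: compact_closure)
  have cg: "continuous_on S g" for S
    unfolding g_def[abs_def] by (intro continuous_intros continuous_r) auto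
  have ch: "continuous_on S h" for S
    unfolding h_def[abs_def]
    by (intro continuous_intros cg continuous_on_compose2[OF linear_continuous_on[OF matrix_vector_mul_bounded_linear] continuous_gr]) auto
  have "bounded (g ` closure U)" "bounded (h ` closure U)"
    by (intro compact_imp_bounded compact_continuous_image cg ch cl)+
  then obtain B C where B: "\<forall>x\<in>closure U. norm (g x) \<le> B" and C: "\<forall>x\<in>closure U. norm (h x) \<le> C"
    unfolding bounded_iff by auto
  have "\<bar>g x\<bar> \<le> max B (C\<^sup>2) \<and> (norm (h x))\<^sup>2 \<le> max B (C\<^sup>2)" if "x \<in> U" for x
  proof -
    have x: "x \<in> closure U" using that closure_subset by blast
    have "(norm (h x))\<^sup>2 \<le> C\<^sup>2" using C x by (intro power_mono) auto
    moreover have "\<bar>g x\<bar> \<le> B" using B x by simp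
    ultimately show ?thesis by linarith
  qed
  then show ?thesis by (intro exI[of _ "max B (C\<^sup>2)"] ballI)
qed

text \<open>Along a segment the second derivative of \<open>g\<close> is g/4 times the square of
  \<open>gr \<bullet> k\<close>, plus g/2 times the Hessian deviation. The first part is nonnegative
  and the second at least \<open>- (B / 2 * w)\<close> times the squared norm of
  \<open>D *v k\<close>. That this constant depends on \<open>B\<close> is harmless, as it does not
  enter the Poincare inequality's conclusion.\<close>

private lemma g_lower_bound:
  assumes "x \<in> U" "y \<in> U" and B: "\<And>x. x \<in> U \<Longrightarrow> \<bar>g x\<bar> \<le> B"
  shows "g x + h x \<bullet> (D *v (y - x)) - (B * w / 2) / 2 * (norm (D *v (y - x)))\<^sup>2 \<le> g y"
proof -
  define k where "k = y - x"
  define c where "c = w * (norm (D *v k))\<^sup>2"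
  have "0 \<le> hess_dev f m D m" unfolding hess_dev_def by (rule opnorm_nonneg)
  then have w0: "0 \<le> w" using w[OF m_U] by linarith
  have hk: "h x \<bullet> (D *v k) = g x / 2 * (gr x \<bullet> k)"
  proof -
    have "(matrix_inv D *v gr x) \<bullet> (D *v k) = gr x \<bullet> k"
      using inner_sym_matrix_inv[OF D_pos, of "gr x" "D *v k"] by (simp only: matrix_inv_cancel[OF D_pos])
    then show ?thesis by (simp add: h_def)
  qed
  define \<phi>' where "\<phi>' t = g (x + t *\<^sub>R k) / 2 * (gr (x + t *\<^sub>R k) \<bullet> k)" for t
  have dg: "((\<lambda>t. g (x + t *\<^sub>R k)) has_real_derivative \<phi>' t) (at t)" for t
  proof -
    have "((\<lambda>t. r (x + t *\<^sub>R k)) has_real_derivative gr (x + t *\<^sub>R k) \<bullet> k) (at t)"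
      by (rule has_real_derivative_along_line[OF r_has_derivative])
    from DERIV_fun_exp[OF DERIV_cdivide[OF this, of 2]] show ?thesis
      by (simp add: g_def \<phi>'_def)
  qed
  have dgr: "((\<lambda>t. gr (x + t *\<^sub>R k) \<bullet> k) has_real_derivative
      ((hessian f (x + t *\<^sub>R k) - hessian f m) *v k) \<bullet> k) (at t)" for t
    by (rule has_real_derivative_along_line[where g = "\<lambda>x. gr x \<bullet> k"])
       (rule has_derivative_inner_left[OF gr_has_derivative])
  have "g (x + 0 *\<^sub>R k) + \<phi>' 0 + (- (B / 2 * c)) / 2 \<le> g (x + 1 *\<^sub>R k)"
  proof (rule second_order_lower_bound)
    fix t :: real assume t: "0 \<le> t" "t \<le> 1"
    define z where "z = x + t *\<^sub>R k"
    define s where "s = ((hessian f z - hessian f m) *v k) \<bullet> k"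
    have zU: "z \<in> U" using segment_U[OF assms(1,2) t] by (simp add: z_def k_def)
    show "((\<lambda>t. g (x + t *\<^sub>R k)) has_real_derivative \<phi>' t) (at t)" by (rule dg)
    show "(\<phi>' has_real_derivative \<phi>' t / 2 * (gr z \<bullet> k) + g z / 2 * s) (at t)"
      using DERIV_mult[OF DERIV_cdivide[OF dg[of t], of 2] dgr[of t]]
      by (simp add: \<phi>'_def[abs_def] s_def z_def mult.commute)
    have "\<bar>k \<bullet> ((hessian f z - hessian f m) *v k)\<bar> \<le> c"
      using hess_dev_bound[OF D_pos, of k f z m k] mult_right_mono[OF w[OF zU], of "(norm (D *v k))\<^sup>2"]
      by (simp add: c_def power2_eq_square mult_ac)
    then have s: "- c \<le> s" by (simp add: s_def inner_commute abs_le_iff)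
    have g: "0 < g z" "g z \<le> B" using B[OF zU] by (auto simp: g_def)
    have "0 \<le> c" using w0 by (simp add: c_def)
    then have "g z / 2 * c \<le> B / 2 * c"
      using g(2) by (intro mult_right_mono) auto
    moreover have "- (g z / 2 * c) \<le> g z / 2 * s"
      using mult_left_mono[OF s, of "g z / 2"] g(1) by linarith
    moreover have "0 \<le> \<phi>' t / 2 * (gr z \<bullet> k)"
    proof -
      have "\<phi>' t / 2 * (gr z \<bullet> k) = g z / 4 * (gr z \<bullet> k)\<^sup>2"
        by (simp add: \<phi>'_def z_def power2_eq_square)
      moreover have "0 \<le> g z / 4 * (gr z \<bullet> k)\<^sup>2" using g(1) by simp
      ultimately show ?thesis by linarith
    qed
    ultimately show "- (B / 2 * c) \<le> \<phi>' t / 2 * (gr z \<bullet> k) + g z / 2 * s"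
      by linarith
  qed
  then show ?thesis
    unfolding k_def[symmetric] hk by (simp add: \<phi>'_def c_def k_def algebra_simps)
qed

lemma continuous_q: "continuous_on S q"
proof -
  have "q = (\<lambda>x. f x - r x)" by (simp add: r_def fun_eq_iff)
  then show ?thesis by (simp only:) (intro continuous_on_diff continuous_f continuous_r)
qed

private lemma measurable_fqgh [measurable]:
  "f \<in> borel_measurable borel" "q \<in> borel_measurable borel" "g \<in> borel_measurable borel"
  "h \<in> borel_measurable borel"
proof -
  show "f \<in> borel_measurable borel" by (intro borel_measurable_continuous_onI continuous_f)
  show "q \<in> borel_measurable borel" by (intro borel_measurable_continuous_onI continuous_q)
  have [measurable]: "gr \<in> borel_measurable borel" by (intro borel_measurable_continuous_onI continuous_gr)
  have [measurable]: "r \<in> borel_measurable borel" by (intro borel_measurable_continuous_onI continuous_r)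
  show "g \<in> borel_measurable borel" unfolding g_def[abs_def] by measurable
  then show "h \<in> borel_measurable borel" unfolding h_def[abs_def] by measurable
qed

lemma integrable_restrict:
  fixes k :: "real ^ 'n \<Rightarrow> real"
  assumes "integrable lborel k"
  shows "integrable lborel (\<lambda>x. indicator U x * k x)"
  using integrable_real_mult_indicator[OF _ assms, of U] by (simp add: mult.commute)

text \<open>The Poincare inequality for \<open>g\<close>, with both sides rewritten as integrals
  against \<open>exp (- f)\<close> and \<open>exp (- q)\<close>. The 1/16 is 1/4 from the squared
  factor in \<open>h\<close> times 1/4 from the square of \<tau>/2.\<close>

lemma affinity_defect:
  "(\<integral>x. indicator U x * exp (- f x) \<partial>lborel) * (\<integral>x. indicator U x * exp (- q x) \<partial>lborel)
     - (\<integral>x. indicator U x * exp (- (f x + q x) / 2) \<partial>lborel)\<^sup>2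
   \<le> (\<integral>x. indicator U x * exp (- f x) \<partial>lborel) / l
       * (\<tau>\<^sup>2 / 16 * (\<integral>x. indicator U x * (norm (D *v (x - m)) ^ 4 * exp (- q x)) \<partial>lborel))"
proof -
  obtain B where B: "\<And>x. x \<in> U \<Longrightarrow> \<bar>g x\<bar> \<le> B" "\<And>x. x \<in> U \<Longrightarrow> (norm (h x))\<^sup>2 \<le> B"
    using g_bounded by blast
  define M where "M = density lborel (\<lambda>x. ennreal (indicator U x * exp (- f x)))"
  have int: "integrable lborel (\<lambda>x. indicator U x * exp (- f x))"
    by (rule integrable_restrict[OF f_int])
  have "measure M UNIV * (\<integral>x. (g x)\<^sup>2 \<partial>M) - (\<integral>x. g x \<partial>M)\<^sup>2
      \<le> measure M UNIV / l * (\<integral>x. (norm (h x))\<^sup>2 \<partial>M)"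
    unfolding M_def
  proof (rule poincare_strongly_convex[OF U U_convex _ _ _ int l_pos])
    show "2 * f ((1 / 2) *\<^sub>R (x + y)) + l / 4 * (norm (D *v (y - x)))\<^sup>2 \<le> f x + f y"
      if "x \<in> U" "y \<in> U" for x y by (rule f_strongly_convex[OF that])
    show "g x + h x \<bullet> (D *v (y - x)) - (B * w / 2) / 2 * (norm (D *v (y - x)))\<^sup>2 \<le> g y"
      if "x \<in> U" "y \<in> U" for x y by (rule g_lower_bound[OF that B(1)])
  qed (use B in measurable)
  moreover have "measure M UNIV = (\<integral>x. indicator U x * exp (- f x) \<partial>lborel)"
    using measure_density_lborel[OF int, of UNIV] by (simp add: M_def)
  moreover have dens: "(\<integral>x. k x \<partial>M) = (\<integral>x. indicator U x * exp (- f x) * k x \<partial>lborel)"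
    if [measurable]: "k \<in> borel_measurable borel" for k :: "real ^ 'n \<Rightarrow> real"
    unfolding M_def by (subst integral_density) auto
  have g_sq: "exp (- f x) * (g x)\<^sup>2 = exp (- q x)" for x
  proof -
    have "(g x)\<^sup>2 = exp (r x)" by (simp add: g_def flip: exp_double)
    then show ?thesis by (simp add: r_def flip: exp_add)
  qed
  have "(\<integral>x. (g x)\<^sup>2 \<partial>M) = (\<integral>x. indicator U x * exp (- q x) \<partial>lborel)"
    by (subst dens) (simp_all add: mult.assoc g_sq)
  moreover have "(\<integral>x. g x \<partial>M) = (\<integral>x. indicator U x * exp (- (f x + q x) / 2) \<partial>lborel)"
    by (subst dens) (auto simp: g_def r_def mult.assoc field_simps simp flip: exp_add intro!: Bochner_Integration.integral_cong)
  moreover have "(\<integral>x. (norm (h x))\<^sup>2 \<partial>M)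
      \<le> \<tau>\<^sup>2 / 16 * (\<integral>x. indicator U x * (norm (D *v (x - m)) ^ 4 * exp (- q x)) \<partial>lborel)"
  proof -
    have bound: "indicator U x * exp (- f x) * (norm (h x))\<^sup>2
        \<le> \<tau>\<^sup>2 / 16 * (indicator U x * (norm (D *v (x - m)) ^ 4 * exp (- q x)))" for x
    proof (cases "x \<in> U")
      case True
      have "(norm (matrix_inv D *v gr x))\<^sup>2 \<le> (\<tau> / 2 * (norm (D *v (x - m)))\<^sup>2)\<^sup>2"
        by (intro power_mono norm_gr_le True) simp
      also have "\<dots> = \<tau>\<^sup>2 / 4 * norm (D *v (x - m)) ^ 4"
        by (simp add: power_mult_distrib power_divide flip: power_mult)
      finally have "exp (- q x) / 4 * (norm (matrix_inv D *v gr x))\<^sup>2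
          \<le> exp (- q x) / 4 * (\<tau>\<^sup>2 / 4 * norm (D *v (x - m)) ^ 4)"
        by (intro mult_left_mono) auto
      moreover have "exp (- f x) * (norm (h x))\<^sup>2 = exp (- q x) / 4 * (norm (matrix_inv D *v gr x))\<^sup>2"
        by (simp add: h_def power_mult_distrib power_divide g_sq flip: mult.assoc)
      ultimately have "exp (- f x) * (norm (h x))\<^sup>2
          \<le> exp (- q x) / 4 * (\<tau>\<^sup>2 / 4 * norm (D *v (x - m)) ^ 4)"
        by (simp only:)
      then show ?thesis using True by (simp add: mult_ac)
    qed simp
    have "(\<integral>x. (norm (h x))\<^sup>2 \<partial>M)
        \<le> (\<integral>x. \<tau>\<^sup>2 / 16 * (indicator U x * (norm (D *v (x - m)) ^ 4 * exp (- q x))) \<partial>lborel)"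
    proof (subst dens)
      show "(\<integral>x. indicator U x * exp (- f x) * (norm (h x))\<^sup>2 \<partial>lborel)
        \<le> (\<integral>x. \<tau>\<^sup>2 / 16 * (indicator U x * (norm (D *v (x - m)) ^ 4 * exp (- q x))) \<partial>lborel)"
      proof (rule integral_mono')
        show "integrable lborel (\<lambda>x. \<tau>\<^sup>2 / 16 * (indicator U x * (norm (D *v (x - m)) ^ 4 * exp (- q x))))"
          by (intro integrable_mult_right integrable_restrict gaussian_quartic_moment DG_pos D_pos)
      qed (use bound in auto)
    qed measurable
    then show ?thesis by simp
  qed
  then have "(\<integral>x. indicator U x * exp (- f x) \<partial>lborel) / l * (\<integral>x. (norm (h x))\<^sup>2 \<partial>M)
      \<le> (\<integral>x. indicator U x * exp (- f x) \<partial>lborel) / l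
       * (\<tau>\<^sup>2 / 16 * (\<integral>x. indicator U x * (norm (D *v (x - m)) ^ 4 * exp (- q x)) \<partial>lborel))"
    using l_pos by (intro mult_left_mono divide_nonneg_pos Bochner_Integration.integral_nonneg) auto
  ultimately show ?thesis by simp
qed

text \<open>Dividing the defect by \<open>u * v\<close> cancels the unknown mass \<open>u\<close>,
  while \<open>v\<close> is \<open>N\<close> times the Gaussian probability of \<open>U\<close>. The
  fourth moment over \<open>U\<close> is bounded by the one over the whole space, whose factor
  \<open>N\<close> cancels as well.\<close>

lemma total_variation_bound_bounded:
  defines "\<pi>\<^sub>f \<equiv> gibbs_measure f" and "\<gamma> \<equiv> gaussian_measure m (matrix_inv (DG ** DG))"
    and "T \<equiv> trace (matrix_inv (DG ** DG) ** (D ** D)) + (opnorm (matrix_inv DG ** D))\<^sup>2"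
  assumes A: "A \<in> sets borel" and \<gamma>U: "0 < measure \<gamma> U"
  shows "\<bar>measure \<pi>\<^sub>f A - measure \<gamma> A\<bar>
      \<le> \<tau> / (4 * sqrt (l * measure \<gamma> U)) * T + measure \<pi>\<^sub>f (- U) + measure \<gamma> (- U)"
proof -
  define N where "N = gaussian_norm_const DG"
  define Z where "Z = (\<integral>x. exp (- f x) \<partial>lborel)"
  define u where "u = (\<integral>x. indicator U x * exp (- f x) \<partial>lborel)"
  define v where "v = (\<integral>x. indicator U x * exp (- q x) \<partial>lborel)"
  define c where "c = (\<integral>x. indicator U x * exp (- (f x + q x) / 2) \<partial>lborel)"
  have N: "0 < N" unfolding N_def by (rule gaussian_norm_const_pos[OF DG_pos])
  have iq: "integrable lborel (\<lambda>x. exp (- q x))" "(\<integral>x. exp (- q x) \<partial>lborel) = N"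
    using gaussian_integral[OF DG_pos, of m] by (simp_all add: has_bochner_integral_iff N_def)
  have iu: "integrable lborel (\<lambda>x. indicator U x * exp (- f x))"
    and iv: "integrable lborel (\<lambda>x. indicator U x * exp (- q x))"
    by (intro integrable_restrict f_int iq)+
  have \<gamma>: "\<gamma> = density lborel (\<lambda>x. ennreal (exp (- q x) / N))"
    unfolding \<gamma>_def N_def by (rule gaussian_measure_eq[OF DG_pos])
  have \<pi>: "\<pi>\<^sub>f = density lborel (\<lambda>x. ennreal (exp (- f x) / Z))"
    by (simp add: \<pi>\<^sub>f_def gibbs_measure_def Z_def)
  have m\<gamma>: "measure \<gamma> S = (\<integral>x. indicator S x * exp (- q x) \<partial>lborel) / N" if "S \<in> sets borel" for S
    unfolding \<gamma> using iq N that by (subst measure_density_lborel) auto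
  have v: "v = N * measure \<gamma> U" "0 < v"
    using \<gamma>U N by (simp_all add: m\<gamma> v_def zero_less_divide_iff)
  \<comment> \<open>Both exponentials are positive everywhere, so the Gaussian and the Gibbs weight
    give \<open>U\<close> mass zero or not simultaneously.\<close>
  have u: "0 < u"
  proof (rule ccontr)
    assume "\<not> 0 < u"
    moreover have "0 \<le> u" unfolding u_def by (intro Bochner_Integration.integral_nonneg) auto
    ultimately have "u = 0" by simp
    then have "AE x in lborel. indicator U x * exp (- f x) = 0"
      unfolding u_def using iu by (subst (asm) integral_nonneg_eq_0_iff_AE) auto
    then have "AE x in lborel. indicator U x * exp (- q x) = 0"
      by eventually_elim simp
    then have "v = 0" unfolding v_def using iv by (subst integral_nonneg_eq_0_iff_AE) auto
    with v show False by simp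
  qed
  have "u \<le> Z" unfolding u_def Z_def using iu f_int
    by (intro integral_mono) (auto simp: indicator_def)
  then have Z: "0 < Z" using u by simp
  have m\<pi>: "measure \<pi>\<^sub>f S = (\<integral>x. indicator S x * exp (- f x) \<partial>lborel) / Z" if "S \<in> sets borel" for S
    unfolding \<pi> using f_int Z that by (subst measure_density_lborel) auto
  have P: "prob_space \<pi>\<^sub>f" "prob_space \<gamma>"
    unfolding \<pi> \<gamma> using f_int iq Z N by (auto intro!: prob_space_density_lborel simp: Z_def)
  have sets: "sets \<pi>\<^sub>f = sets borel" "sets \<gamma> = sets borel" by (simp_all add: \<pi> \<gamma>)
  define e where "e = \<tau> / (4 * sqrt (l * measure \<gamma> U)) * T"
  have T: "0 \<le> T"
    unfolding T_def by (rule order_trans[OF zero_le_power2 gaussian_quartic_moment(3)[OF DG_pos D_pos]])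
  have e: "0 \<le> e" using \<tau>_nonneg T l_pos \<gamma>U by (simp add: e_def)
  define J where "J = (\<integral>x. norm (D *v (x - m)) ^ 4 * exp (- q x) \<partial>lborel)"
  have J: "J \<le> T\<^sup>2 * N"
    unfolding J_def T_def N_def by (rule gaussian_quartic_moment[OF DG_pos D_pos])
  have defect: "1 - c\<^sup>2 / (u * v) \<le> e\<^sup>2"
  proof -
    have iJ: "integrable lborel (\<lambda>x. norm (D *v (x - m)) ^ 4 * exp (- q x))"
      by (rule gaussian_quartic_moment[OF DG_pos D_pos])
    have "(\<integral>x. indicator U x * (norm (D *v (x - m)) ^ 4 * exp (- q x)) \<partial>lborel) \<le> J"
      unfolding J_def using integrable_restrict[OF iJ] iJ
      by (intro integral_mono) (auto simp: indicator_def)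
    also note J
    finally have "u / l * (\<tau>\<^sup>2 / 16 * (\<integral>x. indicator U x * (norm (D *v (x - m)) ^ 4 * exp (- q x)) \<partial>lborel))
        \<le> u / l * (\<tau>\<^sup>2 / 16 * (T\<^sup>2 * N))"
      using u l_pos by (intro mult_left_mono) auto
    then have "u * v - c\<^sup>2 \<le> u / l * (\<tau>\<^sup>2 / 16 * (T\<^sup>2 * N))"
      using affinity_defect by (simp add: u_def v_def c_def)
    then have "(u * v - c\<^sup>2) / (u * v) \<le> (u / l * (\<tau>\<^sup>2 / 16 * (T\<^sup>2 * N))) / (u * v)"
      using u v by (intro divide_right_mono) auto
    also have "\<dots> = \<tau>\<^sup>2 * T\<^sup>2 / (16 * (l * measure \<gamma> U))"
      using u l_pos N \<gamma>U by (simp add: v(1) field_simps)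
    also have "\<dots> = e\<^sup>2"
      using l_pos \<gamma>U by (simp add: e_def power_divide power_mult_distrib)
    finally show ?thesis using u v(2) by (simp add: diff_divide_distrib)
  qed
  \<comment> \<open>The densities of both measures conditioned on \<open>U\<close>; their affinity
    is \<open>c / sqrt (u * v)\<close>.\<close>
  define p where "p x = indicator U x * exp (- f x) / u" for x
  define p' where "p' x = indicator U x * exp (- q x) / v" for x
  have "\<bar>(\<integral>x. indicator A x * p x \<partial>lborel) - (\<integral>x. indicator A x * p' x \<partial>lborel)\<bar>
      \<le> sqrt (1 - (\<integral>x. sqrt (p x * p' x) \<partial>lborel)\<^sup>2)"
    using u v iu iv A by (intro hellinger_bound) (auto simp: p_def p'_def u_def v_def)
  also have "(\<integral>x. sqrt (p x * p' x) \<partial>lborel) = c / sqrt (u * v)"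
  proof -
    have "sqrt (p x * p' x) = indicator U x * exp (- (f x + q x) / 2) / sqrt (u * v)" for x
    proof -
      have "exp (- f x) * exp (- q x) = (exp (- (f x + q x) / 2))\<^sup>2"
        by (simp flip: exp_add exp_double)
      then have "p x * p' x = (indicator U x * exp (- (f x + q x) / 2))\<^sup>2 / (u * v)"
        by (auto simp: p_def p'_def indicator_def)
      then show ?thesis by (simp add: real_sqrt_divide)
    qed
    then show ?thesis by (simp add: c_def)
  qed
  also have "sqrt (1 - (c / sqrt (u * v))\<^sup>2) \<le> sqrt (e\<^sup>2)"
    using defect u v by (intro real_sqrt_le_mono) (simp add: power_divide)
  also have "sqrt (e\<^sup>2) = e" using e by simp
  finally have cond: "\<bar>(\<integral>x. indicator A x * p x \<partial>lborel) - (\<integral>x. indicator A x * p' x \<partial>lborel)\<bar> \<le> e" .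
  have AU: "A \<inter> U \<in> sets borel" using A by auto
  have "measure \<pi>\<^sub>f (A \<inter> U) / measure \<pi>\<^sub>f U = (\<integral>x. indicator A x * p x \<partial>lborel)"
    using Z by (simp add: m\<pi> AU p_def u_def[symmetric] indicator_inter_arith mult.assoc)
  moreover have "measure \<gamma> (A \<inter> U) / measure \<gamma> U = (\<integral>x. indicator A x * p' x \<partial>lborel)"
    using N by (simp add: m\<gamma> AU p'_def v_def[symmetric] indicator_inter_arith mult.assoc)
  moreover have "0 < measure \<pi>\<^sub>f U" using u Z by (simp add: m\<pi> u_def[symmetric])
  ultimately have "measure \<pi>\<^sub>f A - measure \<gamma> A \<le> e + measure \<pi>\<^sub>f (- U) + measure \<gamma> (- U)"
    "measure \<gamma> A - measure \<pi>\<^sub>f A \<le> e + measure \<gamma> (- U) + measure \<pi>\<^sub>f (- U)"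
    using cond e by (intro measure_diff_le_conditional P sets A U \<gamma>U; simp)+
  then show ?thesis by (simp add: e_def abs_le_iff)
qed

end

section \<open>Arbitrary convex \<open>U\<close>\<close>

lemma ennreal_top_divide_mult:
  assumes "0 < t"
  shows "top / ennreal c * ennreal t = top"
  using assms by (auto simp: divide_ennreal_def ennreal_top_mult ennreal_mult_top)

text \<open>The inequality lives in [0,\<infinity>] because \<open>tau3\<close> may be infinite. A
  positive \<open>lam\<close> is a real number, so \<open>real_of_ereal\<close> loses nothing.
  Convexity of \<open>U\<close> keeps the midpoints and segments of the estimates inside
  \<open>U\<close>.\<close>

theorem theorem2p5:
  fixes f :: "real ^ 'n \<Rightarrow> real"
    and m :: "real ^ 'n"
    and DG D :: "real ^ 'n ^ 'n"
    and U :: "(real ^ 'n) set"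
  assumes f_diff: "thrice_differentiable f"
    and f_min: "\<And>x. x \<noteq> m \<Longrightarrow> f m < f x"
    and f_int: "integrable lborel (\<lambda>x. exp (- f x))"
    and DG_pos: "sym_pos_def DG"
    and DG_sq: "DG ** DG = hessian f m"
    and U_meas: "U \<in> sets borel"
    and U_convex: "convex U"
    and m_U: "m \<in> U"
    and D_pos: "sym_pos_def D"
    and lam_pos: "0 < lam f m DG U D"
  defines "pi_f \<equiv> gibbs_measure f"
    and "gamma_f \<equiv> gaussian_measure m (matrix_inv (DG ** DG))"
  shows "ennreal (TV pi_f gamma_f)
       \<le> tau3 f m U D / ennreal (4 * sqrt (real_of_ereal (lam f m DG U D) * measure gamma_f U))
           * ennreal (trace (matrix_inv (DG ** DG) ** (D ** D)) + (opnorm (matrix_inv DG ** D))\<^sup>2)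
         + ennreal (measure pi_f (- U)) + ennreal (measure gamma_f (- U))"
proof -
  define T where "T = trace (matrix_inv (DG ** DG) ** (D ** D)) + (opnorm (matrix_inv DG ** D))\<^sup>2"
  \<comment> \<open>An infinite \<open>omega3\<close> would make \<open>lam\<close> equal to minus
    infinity.\<close>
  obtain w where w: "0 \<le> w" "omega3 f m U D = ennreal w"
    using lam_pos by (cases "omega3 f m U D") (auto simp: lam_def)
  define l where "l = 1 / (alpha DG D)\<^sup>2 - w"
  have l: "lam f m DG U D = ereal l"
    using w by (simp add: lam_def l_def)
  then have l_pos: "0 < l" using lam_pos by simp
  have hess_w: "hess_dev f m D x \<le> w" if "x \<in> U" for x
  proof -
    have "ennreal (hess_dev f m D x) \<le> ennreal w"
      unfolding w(2)[symmetric] omega3_def using that by (rule SUP_upper)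
    then show ?thesis using w(1) by (simp add: ennreal_le_iff)
  qed
  have "continuous_on UNIV f"
    using f_diff has_derivative_gradient
    by (intro continuous_at_imp_continuous_on ballI has_derivative_continuous[of f]) (auto simp: thrice_differentiable_def)
  then have [measurable]: "f \<in> borel_measurable borel" by (rule borel_measurable_continuous_onI)
  have Z: "0 < (\<integral>x. exp (- f x) \<partial>lborel)"
  proof -
    have "\<not> (AE x in lborel. exp (- f x) = 0)"
    proof
      assume "AE x in lborel. exp (- f x) = 0"
      then have "AE x::real^'n in lborel. x \<notin> UNIV" by simp
      then have "UNIV \<in> null_sets (lborel :: (real ^ 'n) measure)"
        by (subst (asm) AE_iff_null_sets[symmetric]) auto
      then show False by (simp add: null_sets_def)
    qed
    then show ?thesis
      using f_int integral_nonneg_eq_0_iff_AE[OF f_int]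
      by (auto simp: less_le intro: Bochner_Integration.integral_nonneg)
  qed
  have P: "prob_space pi_f"
    unfolding pi_f_def gibbs_measure_def using f_int Z by (intro prob_space_density_lborel) auto
  have G: "prob_space gamma_f"
    unfolding gamma_f_def gaussian_measure_eq[OF DG_pos]
    using gaussian_integral[OF DG_pos, of m] gaussian_norm_const_pos[OF DG_pos]
    by (intro prob_space_density_lborel) (auto simp: has_bochner_integral_iff)
  interpret P: prob_space pi_f by (rule P)
  interpret G: prob_space gamma_f by (rule G)
  have sets: "sets pi_f = sets borel" "sets gamma_f = sets borel"
    by (simp_all add: pi_f_def gibbs_measure_def gamma_f_def gaussian_measure_def)
  have TV_le: "TV pi_f gamma_f \<le> b"
    if "\<And>A. A \<in> sets borel \<Longrightarrow> \<bar>measure pi_f A - measure gamma_f A\<bar> \<le> b" for b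
    unfolding TV_def sets by (intro cSUP_least) (use that in auto)
  have T_pos: "0 < T"
    using gaussian_quartic_moment(3)[OF DG_pos D_pos] alpha_pos[OF DG_pos D_pos]
    unfolding T_def alpha_def by (meson less_le_trans zero_less_power)
  show ?thesis
  \<comment> \<open>The degenerate values. If \<open>U\<close> is a Gaussian null set, its
    complement already contributes 1, which dominates any total variation. If \<open>tau3\<close> is
    infinite, so is the right-hand side, because \<open>T\<close> is positive.\<close>
  proof (cases "measure gamma_f U = 0 \<or> tau3 f m U D = top")
    case True
    then show ?thesis
    proof
      assume "measure gamma_f U = 0"
      then have "measure gamma_f (- U) = 1"
        using G.prob_compl[of U] U_meas sets_eq_imp_space_eq[OF sets(2)] by (simp add: sets Compl_eq_Diff_UNIV)
      moreover have "TV pi_f gamma_f \<le> 1"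
      proof (rule TV_le)
        fix A
        show "\<bar>measure pi_f A - measure gamma_f A\<bar> \<le> 1"
          using P.prob_le_1[of A] G.prob_le_1[of A] measure_nonneg[of pi_f A] measure_nonneg[of gamma_f A]
          by linarith
      qed
      ultimately show ?thesis
        by (intro order_trans[OF _ add_increasing[OF _ order_refl]]) auto
    qed (simp add: ennreal_top_divide_mult T_pos flip: T_def)
  next
    case False
    then have \<gamma>U: "0 < measure gamma_f U" by (simp add: zero_less_measure_iff)
    obtain \<tau> where \<tau>: "0 \<le> \<tau>" "tau3 f m U D = ennreal \<tau>"
      using False by (cases "tau3 f m U D") auto
    \<comment> \<open>The supremum in \<open>tau3\<close> leaves out \<open>m\<close>, where the
      deviation is 0.\<close>
    have hess_\<tau>: "hess_dev f m D x \<le> \<tau> * norm (D *v (x - m))" if x: "x \<in> U" for x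
    proof (cases "x = m")
      case True
      have "hess_dev f m D m \<le> 0"
        unfolding hess_dev_def by (rule opnorm_leI) simp
      with True \<tau>(1) show ?thesis by simp
    next
      case False
      then have pos: "0 < norm (D *v (x - m))"
        using matrix_inv_cancel(1)[OF D_pos, of "x - m"] by auto
      have "ennreal (hess_dev f m D x / norm (D *v (x - m))) \<le> ennreal \<tau>"
        unfolding \<tau>(2)[symmetric] tau3_def using x False by (intro SUP_upper) auto
      then show ?thesis
        using \<tau>(1) pos by (simp add: ennreal_le_iff divide_le_eq)
    qed
    have bound: "\<bar>measure pi_f A - measure gamma_f A\<bar>
        \<le> \<tau> / (4 * sqrt (l * measure gamma_f U)) * T + measure pi_f (- U) + measure gamma_f (- U)"
      if A: "A \<in> sets borel" for A
    proof -
      \<comment> \<open>The pieces stay convex, contain \<open>m\<close> and inherit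
        \<open>w\<close> and \<open>\<tau>\<close>, so \<open>l\<close> is the same for all of them.
        Only the masses vary with \<open>k\<close>; they converge, and the Gaussian one is
        eventually positive.\<close>
      define V where "V k = U \<inter> cball m (real k)" for k :: nat
      have V [measurable]: "V k \<in> sets borel" for k using U_meas by (simp add: V_def)
      have incV: "incseq V" by (auto simp: V_def incseq_def)
      have UV: "(\<Union>k. V k) = U"
        using real_arch_simple by (auto simp: V_def)
      have lim: "(\<lambda>k. measure M (V k)) \<longlonglongrightarrow> measure M U"
        and lim_compl: "(\<lambda>k. measure M (- V k)) \<longlonglongrightarrow> measure M (- U)"
        if M: "prob_space M" "sets M = sets borel" for M
      proof -
        interpret M: prob_space M by fact
        have "range V \<subseteq> sets M" using V M(2) by blast
        from M.finite_Lim_measure_incseq[OF this incV]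
        show *: "(\<lambda>k. measure M (V k)) \<longlonglongrightarrow> measure M U" unfolding UV .
        have compl: "measure M (- B) = 1 - measure M B" if "B \<in> sets borel" for B
          using M.prob_compl[of B] that M(2) sets_eq_imp_space_eq[OF M(2)]
          by (simp add: Compl_eq_Diff_UNIV)
        show "(\<lambda>k. measure M (- V k)) \<longlonglongrightarrow> measure M (- U)"
          unfolding compl[OF U_meas] compl[OF V] by (rule tendsto_diff[OF tendsto_const *])
      qed
      have "(\<lambda>k. \<tau> / (4 * sqrt (l * measure gamma_f (V k))) * T + measure pi_f (- V k) + measure gamma_f (- V k))
          \<longlonglongrightarrow> \<tau> / (4 * sqrt (l * measure gamma_f U)) * T + measure pi_f (- U) + measure gamma_f (- U)"
        using l_pos \<gamma>U by (intro tendsto_intros lim lim_compl P G sets) auto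
      moreover have "\<forall>\<^sub>F k in sequentially. \<bar>measure pi_f A - measure gamma_f A\<bar>
          \<le> \<tau> / (4 * sqrt (l * measure gamma_f (V k))) * T + measure pi_f (- V k) + measure gamma_f (- V k)"
        using order_tendstoD(1)[OF lim[OF G sets(2)] \<gamma>U]
      proof eventually_elim
        fix k assume pos: "0 < measure gamma_f (V k)"
        show "\<bar>measure pi_f A - measure gamma_f A\<bar>
          \<le> \<tau> / (4 * sqrt (l * measure gamma_f (V k))) * T + measure pi_f (- V k) + measure gamma_f (- V k)"
          unfolding T_def pi_f_def gamma_f_def
        proof (rule total_variation_bound_bounded[OF f_diff _ f_int DG_pos DG_sq D_pos V _ _ _ _ _ \<tau>(1) l_def l_pos A])
          show "f m \<le> f x" for x using f_min[of x] by (cases "x = m") auto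
          show "convex (V k)" "bounded (V k)" "m \<in> V k"
            using U_convex m_U by (auto simp: V_def convex_Int bounded_Int)
          show "hess_dev f m D x \<le> w" "hess_dev f m D x \<le> \<tau> * norm (D *v (x - m))" if "x \<in> V k" for x
            using that hess_w hess_\<tau> by (auto simp: V_def)
          show "0 < measure (gaussian_measure m (matrix_inv (DG ** DG))) (V k)"
            using pos by (simp add: gamma_f_def)
        qed
      qed
      ultimately show ?thesis
        by (intro tendsto_lowerbound[where F = sequentially]) auto
    qed
    have c: "0 < 4 * sqrt (l * measure gamma_f U)" using l_pos \<gamma>U by simp
    have "ennreal (TV pi_f gamma_f)
        \<le> ennreal (\<tau> / (4 * sqrt (l * measure gamma_f U)) * T + measure pi_f (- U) + measure gamma_f (- U))"
      by (intro ennreal_leI TV_le bound)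
    also have "\<dots> = ennreal \<tau> / ennreal (4 * sqrt (l * measure gamma_f U)) * ennreal T
        + ennreal (measure pi_f (- U)) + ennreal (measure gamma_f (- U))"
      unfolding divide_ennreal[OF \<tau>(1) c] using \<tau>(1) c T_pos
      by (simp only: ennreal_mult'[symmetric] divide_nonneg_pos less_imp_le)
         (simp add: mult_nonneg_nonneg add_nonneg_nonneg)
    finally show ?thesis
      by (simp add: \<tau>(2) l T_def)
  qed
qed

end
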